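(* There is an absolute constant $c>0$ such that the following holds. Let $n\ge1$, $\alpha\in(0,1]$, and let $A\subset\mathbb{F}_5^n$ be a set of size at least $\alpha\cdot 5^n$. Then $A+A+A$ contains an affine subspace of dimension at least \[ \frac{c\,n}{\log(2/\alpha)^3}-\log(1/\alpha). \]
   Context: $A+A+A=\{a_1+a_2+a_3:a_i\in A\}$. *)

theory Defs
  imports
    Complex_Main
    "HOL-Library.Function_Algebras"
    "HOL-Library.Set_Algebras"
    "Berlekamp_Zassenhaus.Finite_Field"
begin

text \<open>
  The numeral type \<open>5\<close> is built from several type constructors, so it cannot be made an
  instance of \<open>prime_card\<close> on its own; an atomic index type with five elements can, and
  \<open>mod_ring\<close> over it is the field of integers modulo 5.
\<close>

typedef five = "{..<5::nat}"
  by (rule exI[of _ 0]) simp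

lemma CARD_five [simp]: "CARD(five) = 5"
  by (simp add: type_definition.card[OF type_definition_five])

instance five :: prime_card
  by intro_classes simp

type_synonym gf5 = "five mod_ring"

text \<open>
  The dimension \<open>n\<close> is quantified inside the theorem (after the absolute constant), so it
  cannot be a type parameter. Vectors are sequences over the field, and the space of dimension
  \<open>n\<close> consists of those supported on the first \<open>n\<close> coordinates. Addition of vectors is
  pointwise and addition of sets of vectors is the Minkowski sum.
\<close>

definition F5_space :: "nat \<Rightarrow> (nat \<Rightarrow> gf5) set" where
  "F5_space n = {x. \<forall>i\<ge>n. x i = 0}"

definition F5_scale :: "gf5 \<Rightarrow> (nat \<Rightarrow> gf5) \<Rightarrow> nat \<Rightarrow> gf5" where
  "F5_scale c x = (\<lambda>i. c * x i)"

interpretation F5: vector_space F5_scale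
  by unfold_locales (auto simp: F5_scale_def fun_eq_iff algebra_simps)

definition affine_subspace_of_dim :: "nat \<Rightarrow> nat \<Rightarrow> (nat \<Rightarrow> gf5) set \<Rightarrow> bool" where
  "affine_subspace_of_dim n d S \<longleftrightarrow>
     (\<exists>a\<in>F5_space n. \<exists>V\<subseteq>F5_space n. F5.subspace V \<and> F5.dim V = d \<and> S = a +o V)"

end

theory Submission
  imports Defs "HOL-Library.FuncSet" "HOL-Library.Real_Mod" "HOL-Analysis.Convex"
begin

text \<open>
  The argument is Croot--Sisask almost-periodicity followed by Fourier analysis. Choose \<open>y\<close> such
  that \<open>B = A \<inter> (y - A)\<close> has density at least \<open>\<alpha>\<^sup>2\<close>, and let \<open>f x\<close> be the proportion of \<open>b \<in> B\<close> with
  \<open>x - b \<in> A + A\<close>. Since \<open>y - B = B\<close>, the function \<open>f\<close> equals 1 on \<open>y + A\<close>, and \<open>f x > 0\<close> forces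
  \<open>x \<in> A + A + A\<close>. So it suffices to find a subspace \<open>W\<close> and \<open>x \<in> y + A\<close> with \<open>f > 0\<close> on \<open>x + W\<close>.

  Random sampling from \<open>B\<close> gives a dense set \<open>T\<close> whose differences are almost-periods of \<open>f\<close>, apart
  from an exceptional set so sparse that a union bound over \<open>W\<close> is affordable. Let \<open>F\<close> be
  \<open>f\<close> averaged \<open>k\<close> times over \<open>T - T\<close>, with \<open>k\<close> of order \<open>ln (2 / \<alpha>)\<close>. Then \<open>F\<close> is close to \<open>f\<close>, and it is
  almost invariant under every vector annihilated by the large spectrum of \<open>T\<close>. By Chang's theorem
  these vectors form a subspace of codimension \<open>O(ln (5 ^ n / |T|))\<close>, and inside it \<open>W\<close> can be
  chosen freely.
\<close>

section \<open>Exponential moments\<close>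

lemma exp_le_quadratic:
  fixes y :: real
  assumes "\<bar>y\<bar> \<le> 1"
  shows "exp y \<le> 1 + y + y\<^sup>2"
proof (cases "y \<ge> 0")
  case True
  then show ?thesis using exp_bound[of y] assms by simp
next
  case False
  define z where "z = - y"
  have z: "0 < z" "z \<le> 1" using False assms by (auto simp: z_def)
  have "(1 + z) * exp (- z) \<le> exp z * exp (- z)"
    using exp_ge_add_one_self[of z] by (intro mult_right_mono) auto
  also have "\<dots> = 1" by (simp flip: exp_add)
  \<comment> \<open>The product equals 1 + z^3.\<close>
  also have "\<dots> \<le> (1 + z) * (1 - z + z\<^sup>2)"
    using z by (simp add: algebra_simps power2_eq_square)
  finally show ?thesis using z by (simp add: z_def)
qed

text \<open>The mean-zero hypothesis kills the linear term of \<open>exp_le_quadratic\<close>. This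
  serves both the Chernoff bound for samples and the moment of a single character in Chang's
  theorem.\<close>

lemma sum_exp_mean_zero_le:
  fixes h :: "'b \<Rightarrow> real"
  assumes "\<And>b. b \<in> B \<Longrightarrow> \<bar>h b\<bar> \<le> 1" and "(\<Sum>b\<in>B. h b) = 0" and "\<bar>c\<bar> \<le> 1"
  shows "(\<Sum>b\<in>B. exp (c * h b)) \<le> real (card B) * exp (c\<^sup>2)"
proof -
  have "(\<Sum>b\<in>B. exp (c * h b)) \<le> (\<Sum>b\<in>B. (1 + c\<^sup>2) + c * h b)"
  proof (rule sum_mono)
    fix b assume "b \<in> B"
    then have h: "\<bar>h b\<bar> \<le> 1" by (rule assms(1))
    have "\<bar>c * h b\<bar> \<le> 1"
      using mult_mono[OF assms(3) h] by (simp add: abs_mult)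
    then have "exp (c * h b) \<le> 1 + c * h b + (c * h b)\<^sup>2" by (rule exp_le_quadratic)
    moreover have "(c * h b)\<^sup>2 \<le> c\<^sup>2 * 1"
      unfolding power_mult_distrib using h by (intro mult_left_mono) (auto simp: abs_square_le_1)
    ultimately show "exp (c * h b) \<le> (1 + c\<^sup>2) + c * h b" by simp
  qed
  also have "\<dots> = real (card B) * (1 + c\<^sup>2)"
    using assms(2) by (simp add: sum.distrib flip: sum_distrib_left)
  also have "\<dots> \<le> real (card B) * exp (c\<^sup>2)"
    by (intro mult_left_mono exp_ge_add_one_self) auto
  finally show ?thesis .
qed

text \<open>Chernoff's inequality in counting form, for m independent uniform samples from
  \<open>B\<close>. Markov's inequality is applied to the exponential moment with parameter c =
  \<epsilon>/2, which minimises c^2 - c \<epsilon>.\<close>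

lemma card_PiE_sum_gt_le:
  fixes h :: "'b \<Rightarrow> real" and m :: nat and \<epsilon> :: real
  assumes "finite B" and "\<And>b. b \<in> B \<Longrightarrow> \<bar>h b\<bar> \<le> 1" and "(\<Sum>b\<in>B. h b) = 0"
    and "0 \<le> \<epsilon>" "\<epsilon> \<le> 1"
  shows "real (card {a \<in> {..<m} \<rightarrow>\<^sub>E B. \<epsilon> * m < (\<Sum>i<m. h (a i))})
    \<le> exp (- \<epsilon>\<^sup>2 * m / 4) * card B ^ m"
proof -
  let ?P = "{..<m} \<rightarrow>\<^sub>E B" and ?c = "\<epsilon> / 2"
  have fin: "finite ?P" using assms(1) by (simp add: finite_PiE)
  have "real (card {a \<in> ?P. \<epsilon> * m < (\<Sum>i<m. h (a i))}) =
      (\<Sum>a\<in>{a \<in> ?P. \<epsilon> * m < (\<Sum>i<m. h (a i))}. 1)" by simp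
  also have "\<dots> \<le> (\<Sum>a\<in>{a \<in> ?P. \<epsilon> * m < (\<Sum>i<m. h (a i))}.
      exp (- ?c * (\<epsilon> * m)) * (\<Prod>i<m. exp (?c * h (a i))))"
  proof (rule sum_mono)
    fix a assume "a \<in> {a \<in> ?P. \<epsilon> * m < (\<Sum>i<m. h (a i))}"
    then have "?c * (\<epsilon> * m) \<le> ?c * (\<Sum>i<m. h (a i))"
      using assms(4) by (intro mult_left_mono) auto
    then have "1 \<le> exp (- ?c * (\<epsilon> * m) + ?c * (\<Sum>i<m. h (a i)))" by simp
    also have "\<dots> = exp (- ?c * (\<epsilon> * m)) * (\<Prod>i<m. exp (?c * h (a i)))"
      unfolding exp_add by (simp add: sum_distrib_left flip: exp_sum)
    finally show "1 \<le> \<dots>" .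
  qed
  also have "\<dots> \<le> (\<Sum>a\<in>?P. exp (- ?c * (\<epsilon> * m)) * (\<Prod>i<m. exp (?c * h (a i))))"
    by (rule sum_mono2[OF fin]) (blast, simp add: prod_nonneg)
  also have "\<dots> = exp (- ?c * (\<epsilon> * m)) * (\<Prod>i<m. \<Sum>b\<in>B. exp (?c * h b))"
    using assms(1) by (simp only: prod_sum_PiE finite_lessThan sum_distrib_left)
  also have "\<dots> \<le> exp (- ?c * (\<epsilon> * m)) * (\<Prod>i<m. real (card B) * exp (?c\<^sup>2))"
    using assms sum_exp_mean_zero_le[of B h ?c]
    by (intro mult_left_mono prod_mono) (auto intro: sum_nonneg)
  also have "\<dots> = exp (- ?c * (\<epsilon> * m)) * exp (?c\<^sup>2) ^ m * card B ^ m"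
    by (simp add: power_mult_distrib)
  also have "exp (- ?c * (\<epsilon> * m)) * exp (?c\<^sup>2) ^ m = exp (- \<epsilon>\<^sup>2 * m / 4)"
    by (simp add: power2_eq_square field_simps flip: exp_of_nat_mult exp_add)
  finally show ?thesis .
qed

section \<open>Almost-periods of convolutions\<close>

lemma sum_card_swap:
  assumes "finite P" "finite Q"
  shows "(\<Sum>a\<in>P. card {x \<in> Q. R a x}) = (\<Sum>x\<in>Q. card {a \<in> P. R a x})"
proof -
  have "(\<Sum>a\<in>P. card {x \<in> Q. R a x}) = (\<Sum>a\<in>P. \<Sum>x\<in>Q. of_bool (R a x))"
    using assms by (simp add: of_bool_def sum.If_cases Int_def)
  also have "\<dots> = (\<Sum>x\<in>Q. \<Sum>a\<in>P. of_bool (R a x))" by (rule sum.swap)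
  also have "\<dots> = (\<Sum>x\<in>Q. card {a \<in> P. R a x})"
    using assms by (simp add: of_bool_def sum.If_cases Int_def)
  finally show ?thesis .
qed

text \<open>Convolution of \<open>u\<close> with the uniform probability measure on
  \<open>B\<close>.\<close>

definition mean_over :: "'a::ab_group_add set \<Rightarrow> ('a \<Rightarrow> real) \<Rightarrow> 'a \<Rightarrow> real" where
  "mean_over B u x = (\<Sum>b\<in>B. u (x - b)) / card B"

lemma mean_over_bounds:
  assumes "finite B" "B \<noteq> {}" and u: "\<And>x. 0 \<le> u x \<and> u x \<le> 1"
  shows "0 \<le> mean_over B u x \<and> mean_over B u x \<le> 1"
proof -
  have "(\<Sum>b\<in>B. u (x - b)) \<le> (\<Sum>b\<in>B. 1)" using u by (intro sum_mono) auto
  moreover have "0 < real (card B)" using assms by (simp add: card_gt_0_iff)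
  ultimately show ?thesis
    using u by (auto simp: mean_over_def intro!: sum_nonneg divide_nonneg_nonneg)
qed

text \<open>Convolution with the law of a random difference of two elements of \<open>T\<close>.
  Differences are what \<open>exists_almost_periods\<close> controls, and they make the Fourier
  multiplier a squared modulus.\<close>

definition smooth :: "'a::ab_group_add set \<Rightarrow> ('a \<Rightarrow> real) \<Rightarrow> 'a \<Rightarrow> real" where
  "smooth T f x = (\<Sum>t\<in>T. \<Sum>s\<in>T. f (x + t - s)) / (real (card T))\<^sup>2"

text \<open>The dimension is not part of a type, so the ambient group has to be a carrier set inside
  the type of all sequences.\<close>

locale finite_subgroup =
  fixes G :: "'a::ab_group_add set"
  assumes finite_carrier: "finite G"
    and zero_mem: "0 \<in> G"
    and diff_mem: "x \<in> G \<Longrightarrow> y \<in> G \<Longrightarrow> x - y \<in> G"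
begin

lemma uminus_mem: "x \<in> G \<Longrightarrow> - x \<in> G"
  using diff_mem[OF zero_mem] by simp

lemma add_mem: "x \<in> G \<Longrightarrow> y \<in> G \<Longrightarrow> x + y \<in> G"
  using diff_mem[of x "- y"] uminus_mem by simp

lemma card_carrier_pos: "0 < card G"
  using finite_carrier zero_mem by (auto simp: card_gt_0_iff)

lemma sum_translate: "y \<in> G \<Longrightarrow> (\<Sum>x\<in>G. f (x + y)) = (\<Sum>x\<in>G. f x)"
  by (rule sum.reindex_bij_witness[of _ "\<lambda>x. x - y" "\<lambda>x. x + y"]) (auto intro: diff_mem add_mem)

lemma sum_translate': "y \<in> G \<Longrightarrow> (\<Sum>x\<in>G. f (x - y)) = (\<Sum>x\<in>G. f x)"
  using sum_translate[of "- y" f] uminus_mem by simp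

lemma sum_reflect: "y \<in> G \<Longrightarrow> (\<Sum>x\<in>G. f (y - x)) = (\<Sum>x\<in>G. f x)"
  by (rule sum.reindex_bij_witness[of _ "\<lambda>x. y - x" "\<lambda>x. y - x"]) (auto intro: diff_mem)

text \<open>The centred values \<open>u (x - b) - mean_over B u x\<close> lie in [-1, 1] and sum to
  zero over \<open>B\<close>, so the Chernoff bound applies to them and to their negatives; hence
  the factor 2.\<close>

lemma card_bad_samples_le:
  fixes m :: nat and \<epsilon> :: real
  assumes "finite B" "B \<noteq> {}" and u: "\<And>x. 0 \<le> u x \<and> u x \<le> 1"
    and "0 \<le> \<epsilon>" "\<epsilon> \<le> 1"
  shows "real (card {a \<in> {..<m} \<rightarrow>\<^sub>E B. \<epsilon> * m < \<bar>(\<Sum>i<m. u (x - a i)) - m * mean_over B u x\<bar>})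
    \<le> 2 * exp (- \<epsilon>\<^sup>2 * m / 4) * card B ^ m"
proof -
  let ?h = "\<lambda>b. u (x - b) - mean_over B u x" and ?P = "{..<m} \<rightarrow>\<^sub>E B"
  have cB: "card B > 0" using assms by (simp add: card_gt_0_iff)
  have m: "0 \<le> mean_over B u x" "mean_over B u x \<le> 1"
    using mean_over_bounds[OF assms(1,2) u] by auto
  have h: "\<bar>?h b\<bar> \<le> 1" for b using m u[of "x - b"] by auto
  have h0: "(\<Sum>b\<in>B. ?h b) = 0" using cB by (simp add: sum_subtractf mean_over_def)
  have eq: "(\<Sum>i<m. u (x - a i)) - m * mean_over B u x = (\<Sum>i<m. ?h (a i))" for a
    by (simp add: sum_subtractf)
  have fin: "finite ?P" using assms(1) by (simp add: finite_PiE)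
  have "{a \<in> ?P. \<epsilon> * m < \<bar>(\<Sum>i<m. u (x - a i)) - m * mean_over B u x\<bar>} \<subseteq>
      {a \<in> ?P. \<epsilon> * m < (\<Sum>i<m. ?h (a i))} \<union> {a \<in> ?P. \<epsilon> * m < (\<Sum>i<m. - ?h (a i))}"
  proof
    fix a
    assume a: "a \<in> {a \<in> ?P. \<epsilon> * m < \<bar>(\<Sum>i<m. u (x - a i)) - m * mean_over B u x\<bar>}"
    then have "\<epsilon> * m < (\<Sum>i<m. ?h (a i)) \<or> \<epsilon> * m < (\<Sum>i<m. - ?h (a i))"
      unfolding eq sum_negf by (simp only: mem_Collect_eq) arith
    then show "a \<in> {a \<in> ?P. \<epsilon> * m < (\<Sum>i<m. ?h (a i))} \<union> {a \<in> ?P. \<epsilon> * m < (\<Sum>i<m. - ?h (a i))}"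
      using a by blast
  qed
  then have "card {a \<in> ?P. \<epsilon> * m < \<bar>(\<Sum>i<m. u (x - a i)) - m * mean_over B u x\<bar>} \<le>
      card {a \<in> ?P. \<epsilon> * m < (\<Sum>i<m. ?h (a i))} + card {a \<in> ?P. \<epsilon> * m < (\<Sum>i<m. - ?h (a i))}"
    using fin by (intro order.trans[OF card_mono card_Un_le]) auto
  moreover have "real (card {a \<in> ?P. \<epsilon> * m < (\<Sum>i<m. ?h (a i))})
      \<le> exp (- \<epsilon>\<^sup>2 * m / 4) * card B ^ m"
    using assms h h0 by (intro card_PiE_sum_gt_le) auto
  moreover have "real (card {a \<in> ?P. \<epsilon> * m < (\<Sum>i<m. - ?h (a i))})
      \<le> exp (- \<epsilon>\<^sup>2 * m / 4) * card B ^ m"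
  proof (rule card_PiE_sum_gt_le[where h = "\<lambda>b. - ?h b"])
    show "(\<Sum>b\<in>B. - ?h b) = 0" unfolding sum_negf h0 by simp
  qed (use assms h in \<open>auto simp: abs_minus_commute\<close>)
  ultimately show ?thesis by linarith
qed

text \<open>
  Two \<open>m\<close>-tuples of samples which are both good and which differ by a diagonal shift by \<open>t - s\<close> show
  that \<open>t - s\<close> is an almost-period; pigeonholing over the shifts of the good tuples yields many such \<open>t\<close>.
\<close>
lemma exists_almost_periods:
  fixes m :: nat and \<epsilon> :: real
  assumes B: "B \<subseteq> G" "B \<noteq> {}" and u: "\<And>x. 0 \<le> u x \<and> u x \<le> 1"
    and \<epsilon>: "0 \<le> \<epsilon>" "\<epsilon> \<le> 1" and m: "0 < m"
  shows "\<exists>T g. T \<subseteq> G \<and> T \<noteq> {} \<and>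
    real (card B) ^ m * card G \<le> 2 * card T * real (card G) ^ m \<and>
    (\<forall>t\<in>T. real (card {x \<in> G. \<epsilon> < \<bar>mean_over B u (x + t) - g x\<bar>})
      \<le> 4 * exp (- \<epsilon>\<^sup>2 * m / 4) * card G)"
proof -
  let ?P = "{..<m} \<rightarrow>\<^sub>E B" and ?Q = "{..<m} \<rightarrow>\<^sub>E G" and ?e = "exp (- \<epsilon>\<^sup>2 * m / 4)"
  define N where "N = real (card G)"
  have N: "N > 0" using card_carrier_pos by (simp add: N_def)
  define D where "D = (\<lambda>a x. \<bar>(\<Sum>i<m. u (x - a i)) - m * mean_over B u x\<bar>)"
  \<comment> \<open>The threshold is twice the average number of exceptional points allowed by the
    sampling bound, so by Markov at least half of all tuples lie in \<open>L\<close>.\<close>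
  define L where "L = {a \<in> ?P. real (card {x \<in> G. \<epsilon> * m < D a x}) \<le> 4 * ?e * N}"
  have finB: "finite B" using B finite_carrier finite_subset by blast
  have cB: "0 < real (card B)" using finB B by (simp add: card_gt_0_iff)
  have finP: "finite ?P" "finite ?Q" using finB finite_carrier by (simp_all add: finite_PiE)
  have cP: "card ?P = card B ^ m" "card ?Q = card G ^ m" by (simp_all add: card_PiE)
  have "real (\<Sum>a\<in>?P. card {x \<in> G. \<epsilon> * m < D a x}) =
      (\<Sum>x\<in>G. real (card {a \<in> ?P. \<epsilon> * m < D a x}))"
    by (subst sum_card_swap) (use finP finite_carrier in auto)
  also have "\<dots> \<le> (\<Sum>x\<in>G. 2 * ?e * card B ^ m)"
    unfolding D_def using card_bad_samples_le[OF finB B(2) u \<epsilon>] by (intro sum_mono) auto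
  also have "\<dots> = 2 * ?e * N * card B ^ m" by (simp add: N_def)
  finally have tot: "(\<Sum>a\<in>?P. real (card {x \<in> G. \<epsilon> * m < D a x})) \<le> 2 * ?e * N * card B ^ m"
    by simp
  have "(4 * ?e * N) * card (?P - L) = (\<Sum>a\<in>?P - L. 4 * ?e * N)" by simp
  also have "\<dots> \<le> (\<Sum>a\<in>?P - L. real (card {x \<in> G. \<epsilon> * m < D a x}))"
    by (rule sum_mono) (simp only: L_def Diff_iff mem_Collect_eq, linarith)
  also have "\<dots> \<le> (\<Sum>a\<in>?P. real (card {x \<in> G. \<epsilon> * m < D a x}))"
    by (rule sum_mono2[OF finP(1)]) simp_all
  also note tot
  finally have "(2 * ?e * N) * (2 * card (?P - L)) \<le> (2 * ?e * N) * card B ^ m"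
    by (simp add: algebra_simps)
  then have "2 * real (card (?P - L)) \<le> card B ^ m"
    using N by (simp add: mult_le_cancel_left_pos)
  moreover have "L \<subseteq> ?P" by (auto simp: L_def)
  then have "card (?P - L) = card ?P - card L" "card L \<le> card ?P"
    using finP by (auto intro: card_Diff_subset card_mono finite_subset)
  ultimately have L: "real (card B) ^ m \<le> 2 * card L"
    using cP(1) by (simp add: of_nat_diff)
  \<comment> \<open>Base tuples range over all of \<open>G\<close>, not only \<open>B\<close>; only
    the shifted tuple has to be a good sample from \<open>B\<close>.\<close>
  define sh :: "(nat \<Rightarrow> 'a) \<Rightarrow> 'a \<Rightarrow> nat \<Rightarrow> 'a"
    where "sh = (\<lambda>b t. \<lambda>i\<in>{..<m}. b i + t)"
  have shift: "card {b \<in> ?Q. sh b t \<in> L} = card L" if t: "t \<in> G" for t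
  proof (rule bij_betw_same_card[where f = "\<lambda>b. sh b t"], rule bij_betwI[where g = "\<lambda>b. sh b (- t)"])
    show "(\<lambda>b. sh b (- t)) \<in> L \<rightarrow> {b \<in> ?Q. sh b t \<in> L}"
    proof
      fix b assume b: "b \<in> L"
      then have "b \<in> ?P" by (simp add: L_def)
      then have bG: "b i \<in> G" if "i < m" for i using that B by auto
      have "sh (sh b (- t)) t = b"
        using \<open>b \<in> ?P\<close> by (auto simp: sh_def fun_eq_iff PiE_def extensional_def)
      then show "sh b (- t) \<in> {b \<in> ?Q. sh b t \<in> L}"
        using b bG t diff_mem by (auto simp: sh_def)
    qed
  qed (auto simp: sh_def fun_eq_iff PiE_def extensional_def L_def)
  have "(\<Sum>b\<in>?Q. real (card {t \<in> G. sh b t \<in> L})) = real (\<Sum>t\<in>G. card {b \<in> ?Q. sh b t \<in> L})"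
    by (subst sum_card_swap[symmetric]) (use finP finite_carrier in auto)
  also have "\<dots> = N * card L" using shift by (simp add: N_def)
  finally have sumQ: "(\<Sum>b\<in>?Q. real (card {t \<in> G. sh b t \<in> L})) = N * card L" .
  have "\<exists>b\<in>?Q. N * card L / card ?Q \<le> card {t \<in> G. sh b t \<in> L}"
  proof (rule ccontr)
    assume "\<not> ?thesis"
    moreover have "?Q \<noteq> {}" using zero_mem by (auto simp: PiE_eq_empty_iff)
    ultimately have "(\<Sum>b\<in>?Q. real (card {t \<in> G. sh b t \<in> L})) < (\<Sum>b\<in>?Q. N * card L / card ?Q)"
      using finP by (intro sum_strict_mono) auto
    also have "\<dots> = N * card L" using finP \<open>?Q \<noteq> {}\<close> by simp
    finally show False using sumQ by simp
  qed
  then obtain b where b: "b \<in> ?Q" "N * card L / card ?Q \<le> card {t \<in> G. sh b t \<in> L}" by blast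
  define T where "T = {t \<in> G. sh b t \<in> L}"
  \<comment> \<open>Evaluating the sample shifted by \<open>t\<close> at the point
    \<open>x + t\<close> gives \<open>g x\<close> for every \<open>t\<close>, so one
    \<open>g\<close> serves all of \<open>T\<close>.\<close>
  define g where "g = (\<lambda>x. (\<Sum>i<m. u (x - b i)) / m)"
  have le: "real (card B) ^ m * card G \<le> 2 * card T * real (card G) ^ m"
  proof -
    have "N * card L \<le> card T * N ^ m"
      using b(2) N cP by (simp add: T_def field_simps N_def)
    moreover have "real (card B) ^ m * N \<le> 2 * card L * N"
      using L N by (intro mult_right_mono) auto
    ultimately show ?thesis by (simp add: N_def algebra_simps)
  qed
  have "T \<noteq> {}"
  proof
    assume "T = {}"
    then have "real (card B) ^ m * N \<le> 0" using le by (simp add: N_def)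
    moreover have "real (card B) ^ m * N > 0" using cB N by simp
    ultimately show False by linarith
  qed
  have "real (card {x \<in> G. \<epsilon> < \<bar>mean_over B u (x + t) - g x\<bar>}) \<le> 4 * ?e * N" if "t \<in> T" for t
  proof -
    have t: "t \<in> G" "sh b t \<in> L" using that by (auto simp: T_def)
    have "D (sh b t) (x + t) = \<bar>m * g x - m * mean_over B u (x + t)\<bar>" for x
      using m by (simp add: D_def sh_def g_def)
    then have D: "D (sh b t) (x + t) = m * \<bar>mean_over B u (x + t) - g x\<bar>" for x
      using m by (simp add: abs_mult abs_minus_commute flip: right_diff_distrib)
    have "card {x \<in> G. \<epsilon> < \<bar>mean_over B u (x + t) - g x\<bar>} \<le> card {x \<in> G. \<epsilon> * m < D (sh b t) x}"
      using t m finite_carrier D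
      by (intro card_inj_on_le[where f = "\<lambda>x. x + t"]) (auto intro: inj_onI add_mem simp: mult.commute)
    then show ?thesis using t(2) by (simp add: L_def)
  qed
  moreover have "T \<subseteq> G" by (auto simp: T_def)
  ultimately show ?thesis using le \<open>T \<noteq> {}\<close> unfolding N_def by blast
qed

end

section \<open>Iterated averaging over a difference set\<close>

lemma smooth_add: "smooth T (\<lambda>y. f y + g y) x = smooth T f x + smooth T g x"
  by (simp add: smooth_def sum.distrib add_divide_distrib)

lemma smooth_diff: "smooth T (\<lambda>y. f y - g y) x = smooth T f x - smooth T g x"
  by (simp add: smooth_def sum_subtractf diff_divide_distrib)

lemma smooth_const: "finite T \<Longrightarrow> T \<noteq> {} \<Longrightarrow> smooth T (\<lambda>y. c) x = c"
  by (simp add: smooth_def power2_eq_square)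

lemma abs_smooth_le: "\<bar>smooth T f x\<bar> \<le> smooth T (\<lambda>y. \<bar>f y\<bar>) x"
  unfolding smooth_def abs_divide
  by (simp add: divide_right_mono order.trans[OF sum_abs] sum_mono)

text \<open>Two convolutions commute. Smoothing can thus act on \<open>u\<close>, while the average
  over \<open>B\<close> remains available to turn an L2 estimate into a pointwise one.\<close>

lemma smooth_mean_over: "smooth T (mean_over B u) x = mean_over B (smooth T u) x"
proof -
  have "(\<Sum>t\<in>T. \<Sum>s\<in>T. \<Sum>b\<in>B. u (x + t - s - b)) = (\<Sum>t\<in>T. \<Sum>b\<in>B. \<Sum>s\<in>T. u (x + t - s - b))"
    by (intro sum.cong[OF refl] sum.swap)
  also have "\<dots> = (\<Sum>b\<in>B. \<Sum>t\<in>T. \<Sum>s\<in>T. u (x + t - s - b))" by (rule sum.swap)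
  also have "\<dots> = (\<Sum>b\<in>B. \<Sum>t\<in>T. \<Sum>s\<in>T. u (x - b + t - s))" by (simp add: algebra_simps)
  finally show ?thesis
    by (simp add: smooth_def mean_over_def mult.commute flip: sum_divide_distrib)
qed

lemma smooth_iter_mean_over: "(smooth T ^^ k) (mean_over B u) = mean_over B ((smooth T ^^ k) u)"
proof (induction k)
  case (Suc k)
  then show ?case by (simp add: smooth_mean_over[abs_def])
qed simp

context finite_subgroup begin

lemma smooth_mono:
  assumes "T \<subseteq> G" "x \<in> G" "\<And>y. y \<in> G \<Longrightarrow> f y \<le> g y"
  shows "smooth T f x \<le> smooth T g x"
  unfolding smooth_def using assms
  by (intro divide_right_mono sum_mono assms(3) diff_mem add_mem) auto

lemma sum_smooth:
  assumes "T \<subseteq> G" "T \<noteq> {}"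
  shows "(\<Sum>x\<in>G. smooth T f x) = (\<Sum>x\<in>G. f x)"
proof -
  have finT: "finite T" using assms finite_carrier finite_subset by blast
  have "(\<Sum>x\<in>G. \<Sum>t\<in>T. \<Sum>s\<in>T. f (x + t - s)) = (\<Sum>t\<in>T. \<Sum>x\<in>G. \<Sum>s\<in>T. f (x + t - s))"
    by (rule sum.swap)
  also have "\<dots> = (\<Sum>t\<in>T. \<Sum>s\<in>T. \<Sum>x\<in>G. f (x + (t - s)))"
    unfolding add_diff_eq by (intro sum.cong[OF refl] sum.swap)
  also have "\<dots> = (\<Sum>t\<in>T. \<Sum>s\<in>T. \<Sum>x\<in>G. f x)"
    using assms by (intro sum.cong refl sum_translate diff_mem) auto
  finally show ?thesis
    using finT assms by (simp add: smooth_def power2_eq_square flip: sum_divide_distrib)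
qed

text \<open>With z = x - s, both f (z + t) = f (x + t - s) and f (z + s) = f x are within \<epsilon>
  of g z, unless z is exceptional for t or s. The exceptional points are charged to a function
  \<open>h\<close> with small sum.\<close>

lemma smooth_approx:
  assumes T: "T \<subseteq> G" "T \<noteq> {}" and f: "\<And>x. 0 \<le> f x \<and> f x \<le> 1" and "0 \<le> \<epsilon>"
    and bad: "\<And>t. t \<in> T \<Longrightarrow> real (card {x \<in> G. \<epsilon> < \<bar>f (x + t) - g x\<bar>}) \<le> \<eta>"
  shows "\<exists>h. (\<forall>x. 0 \<le> h x) \<and> (\<forall>x\<in>G. \<bar>smooth T f x - f x\<bar> \<le> 2 * \<epsilon> + h x) \<and>
    (\<Sum>x\<in>G. h x) \<le> 2 * \<eta>"
proof -
  define E where "E = (\<lambda>t. {x \<in> G. \<epsilon> < \<bar>f (x + t) - g x\<bar>})"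
  define e :: "'a \<Rightarrow> 'a \<Rightarrow> real" where "e = (\<lambda>t x. of_bool (x \<in> E t))"
  define h where "h = (\<lambda>x. (\<Sum>t\<in>T. \<Sum>s\<in>T. e t (x - s) + e s (x - s)) / (real (card T))\<^sup>2)"
  have finT: "finite T" using T finite_carrier finite_subset by blast
  have cT: "0 < real (card T)" using finT T by (simp add: card_gt_0_iff)
  have "0 \<le> h x" for x by (simp add: h_def e_def sum_nonneg)
  moreover have "\<bar>smooth T f x - f x\<bar> \<le> 2 * \<epsilon> + h x" if x: "x \<in> G" for x
  proof -
    have pt: "\<bar>f (x + t - s) - f x\<bar> \<le> 2 * \<epsilon> + (e t (x - s) + e s (x - s))"
      if "t \<in> T" "s \<in> T" for t s
    proof (cases "x - s \<in> E t \<or> x - s \<in> E s")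
      case True
      then have "1 \<le> e t (x - s) + e s (x - s)" by (auto simp: e_def)
      then show ?thesis using f[of "x + t - s"] f[of x] \<open>0 \<le> \<epsilon>\<close> by linarith
    next
      case False
      have "x - s \<in> G" using x that T diff_mem by blast
      with False have "\<bar>f (x - s + t) - g (x - s)\<bar> \<le> \<epsilon>" "\<bar>f (x - s + s) - g (x - s)\<bar> \<le> \<epsilon>"
        by (auto simp: E_def not_less)
      moreover have "x - s + t = x + t - s" "x - s + s = x" by simp_all
      ultimately show ?thesis using False by (simp add: e_def)
    qed
    have "\<bar>smooth T f x - f x\<bar> = \<bar>smooth T (\<lambda>y. f y - f x) x\<bar>"
      using finT T by (simp add: smooth_diff smooth_const)
    also have "\<dots> \<le> smooth T (\<lambda>y. \<bar>f y - f x\<bar>) x" by (rule abs_smooth_le)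
    also have "\<dots> \<le> (\<Sum>t\<in>T. \<Sum>s\<in>T. 2 * \<epsilon> + (e t (x - s) + e s (x - s))) / (real (card T))\<^sup>2"
      unfolding smooth_def by (intro divide_right_mono sum_mono pt) auto
    also have "\<dots> = smooth T (\<lambda>y. 2 * \<epsilon>) x + h x"
      unfolding sum.distrib[of "\<lambda>s. 2 * \<epsilon>"] sum.distrib[of "\<lambda>t. sum (\<lambda>s. 2 * \<epsilon>) T"] add_divide_distrib
      by (simp add: smooth_def h_def)
    finally show ?thesis using finT T by (simp add: smooth_const)
  qed
  moreover have "(\<Sum>x\<in>G. h x) \<le> 2 * \<eta>"
  proof -
    have e_sum: "(\<Sum>x\<in>G. e t (x - s)) \<le> \<eta>" if "t \<in> T" "s \<in> T" for t s
    proof -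
      have "(\<Sum>x\<in>G. e t (x - s)) = (\<Sum>x\<in>G. e t x)"
        using that T by (intro sum_translate') auto
      also have "\<dots> = card (E t)"
        using finite_carrier by (simp add: e_def E_def of_bool_def sum.If_cases Int_def)
      finally show ?thesis using bad[OF that(1)] by (simp add: E_def)
    qed
    have "(\<Sum>x\<in>G. h x) = (\<Sum>t\<in>T. \<Sum>s\<in>T. (\<Sum>x\<in>G. e t (x - s)) + (\<Sum>x\<in>G. e s (x - s))) / (real (card T))\<^sup>2"
    proof -
      have "(\<Sum>x\<in>G. \<Sum>t\<in>T. \<Sum>s\<in>T. e t (x - s) + e s (x - s)) =
          (\<Sum>t\<in>T. \<Sum>x\<in>G. \<Sum>s\<in>T. e t (x - s) + e s (x - s))" by (rule sum.swap)
      also have "\<dots> = (\<Sum>t\<in>T. \<Sum>s\<in>T. \<Sum>x\<in>G. e t (x - s) + e s (x - s))"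
        by (intro sum.cong[OF refl] sum.swap)
      finally show ?thesis by (simp add: h_def sum.distrib flip: sum_divide_distrib)
    qed
    also have "\<dots> \<le> (\<Sum>t\<in>T. \<Sum>s\<in>T. \<eta> + \<eta>) / (real (card T))\<^sup>2"
      by (intro divide_right_mono sum_mono add_mono e_sum) auto
    also have "\<dots> = 2 * \<eta>" using cT by (simp add: power2_eq_square)
    finally show ?thesis .
  qed
  ultimately show ?thesis by blast
qed

text \<open>Smoothing is monotone and preserves constants and total mass, so each round adds just
  one more copy of the error from \<open>smooth_approx\<close>.\<close>

lemma smooth_iter_approx:
  assumes T: "T \<subseteq> G" "T \<noteq> {}" and f: "\<And>x. 0 \<le> f x \<and> f x \<le> 1" and \<epsilon>: "0 \<le> \<epsilon>"
    and bad: "\<And>t. t \<in> T \<Longrightarrow> real (card {x \<in> G. \<epsilon> < \<bar>f (x + t) - g x\<bar>}) \<le> \<eta>"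
  shows "\<exists>h. (\<forall>x. 0 \<le> h x) \<and> (\<forall>x\<in>G. \<bar>(smooth T ^^ k) f x - f x\<bar> \<le> 2 * real k * \<epsilon> + h x) \<and>
    (\<Sum>x\<in>G. h x) \<le> 2 * real k * \<eta>"
proof (induction k)
  case 0
  show ?case by (rule exI[of _ "\<lambda>x. 0"]) simp
next
  case (Suc k)
  have finT: "finite T" using T finite_carrier finite_subset by blast
  obtain h1 where h1: "\<And>x. 0 \<le> h1 x" "\<And>x. x \<in> G \<Longrightarrow> \<bar>smooth T f x - f x\<bar> \<le> 2 * \<epsilon> + h1 x"
    "(\<Sum>x\<in>G. h1 x) \<le> 2 * \<eta>"
    using smooth_approx[OF T f \<epsilon> bad] by blast
  from Suc obtain h where "(\<forall>x. 0 \<le> h x) \<and>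
      (\<forall>x\<in>G. \<bar>(smooth T ^^ k) f x - f x\<bar> \<le> 2 * real k * \<epsilon> + h x) \<and> (\<Sum>x\<in>G. h x) \<le> 2 * real k * \<eta>" ..
  then have h: "0 \<le> h x" "x \<in> G \<Longrightarrow> \<bar>(smooth T ^^ k) f x - f x\<bar> \<le> 2 * real k * \<epsilon> + h x"
    "(\<Sum>x\<in>G. h x) \<le> 2 * real k * \<eta>" for x
    by simp_all
  show ?case
  proof (intro exI[of _ "\<lambda>x. smooth T h x + h1 x"] conjI allI ballI)
    show "0 \<le> smooth T h x + h1 x" for x
      using h(1) h1(1) by (simp add: smooth_def sum_nonneg)
    show "(\<Sum>x\<in>G. smooth T h x + h1 x) \<le> 2 * real (Suc k) * \<eta>"
      using h(3) h1(3) T by (simp add: sum.distrib sum_smooth algebra_simps)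
    fix x assume x: "x \<in> G"
    have "\<bar>smooth T ((smooth T ^^ k) f) x - smooth T f x\<bar> = \<bar>smooth T (\<lambda>y. (smooth T ^^ k) f y - f y) x\<bar>"
      by (simp add: smooth_diff)
    also have "\<dots> \<le> smooth T (\<lambda>y. \<bar>(smooth T ^^ k) f y - f y\<bar>) x" by (rule abs_smooth_le)
    also have "\<dots> \<le> smooth T (\<lambda>y. 2 * real k * \<epsilon> + h y) x" using T(1) x h(2) by (rule smooth_mono)
    also have "\<dots> = 2 * real k * \<epsilon> + smooth T h x"
      using finT T by (simp add: smooth_add smooth_const)
    finally show "\<bar>(smooth T ^^ Suc k) f x - f x\<bar> \<le> 2 * real (Suc k) * \<epsilon> + (smooth T h x + h1 x)"
      using h1(2)[OF x] by (simp add: algebra_simps)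
  qed
qed

end

section \<open>Fourier analysis over the field with five elements\<close>

lemma F5_space_bij: "bij_betw (\<lambda>x. restrict x {..<n}) (F5_space n) ({..<n} \<rightarrow>\<^sub>E (UNIV :: gf5 set))"
  by (rule bij_betwI[where g = "\<lambda>x i. if i < n then x i else 0"])
    (auto simp: F5_space_def fun_eq_iff PiE_def extensional_def)

lemma finite_F5_space: "finite (F5_space n)"
  unfolding bij_betw_finite[OF F5_space_bij] by (rule finite_PiE) auto

lemma card_F5_space: "card (F5_space n) = 5 ^ n"
  using bij_betw_same_card[OF F5_space_bij] by (simp add: card_PiE)

interpretation F5_space: finite_subgroup "F5_space n" for n
  by unfold_locales (rule finite_F5_space, auto simp: F5_space_def)

section \<open>Additive characters and their orthogonality\<close>

definition e5 :: "gf5 \<Rightarrow> complex" where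
  "e5 s = cis (2 * pi * to_int_mod_ring s / 5)"

lemma cis_mod_5: "cis (2 * pi * real_of_int (k mod 5) / 5) = cis (2 * pi * real_of_int k / 5)"
proof -
  have "real_of_int k = real_of_int (5 * (k div 5) + k mod 5)" by simp
  then have "2 * pi * real_of_int k / 5 = 2 * pi * real_of_int (k div 5) + 2 * pi * real_of_int (k mod 5) / 5"
    by (simp only: of_int_add of_int_mult) (simp add: field_simps)
  then have "cis (2 * pi * real_of_int k / 5) =
      cis (2 * pi * real_of_int (k div 5)) * cis (2 * pi * real_of_int (k mod 5) / 5)"
    by (simp only: cis_mult)
  then show ?thesis by (simp add: cis_multiple_2pi)
qed

lemma e5_add: "e5 (s + t) = e5 s * e5 t"
proof -
  have "e5 (s + t) = cis (2 * pi * real_of_int (to_int_mod_ring s + to_int_mod_ring t) / 5)"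
    unfolding e5_def by (simp add: to_int_mod_ring_add cis_mod_5)
  then show ?thesis by (simp add: e5_def cis_mult field_simps)
qed

lemma e5_0 [simp]: "e5 0 = 1" by (simp add: e5_def)

lemma norm_e5 [simp]: "cmod (e5 s) = 1" by (simp add: e5_def)

lemma e5_minus: "e5 (- s) = cnj (e5 s)"
proof -
  have "e5 (- s) * e5 s = 1" by (simp flip: e5_add)
  moreover have "cnj (e5 s) * e5 s = 1"
    using complex_norm_square[of "e5 s"] by (simp add: mult.commute)
  moreover have "e5 s \<noteq> 0" by (simp add: e5_def)
  ultimately show ?thesis by (metis mult_right_cancel)
qed

lemma e5_eq_1_iff: "e5 s = 1 \<longleftrightarrow> s = 0"
proof
  assume "e5 s = 1"
  then obtain k :: int where "2 * pi * to_int_mod_ring s / 5 = of_int k * (2 * pi)"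
    unfolding e5_def cis_eq_1_iff by blast
  then have "real_of_int (to_int_mod_ring s) = real_of_int (5 * k)" by (simp add: field_simps)
  then have k: "to_int_mod_ring s = 5 * k" by linarith
  have "to_int_mod_ring s \<in> {0..<5}" using range_to_int_mod_ring[where 'a = five] by auto
  then have "to_int_mod_ring s = 0" using k by auto
  then show "s = 0" by simp
qed simp

lemma sum_e5: "(\<Sum>s\<in>UNIV. e5 s) = 0"
proof -
  have "(\<Sum>s\<in>UNIV. e5 s) = (\<Sum>s\<in>UNIV. e5 (s + 1))"
    by (rule sum.reindex_bij_witness[of _ "\<lambda>s. s + 1" "\<lambda>s. s - 1"]) auto
  also have "\<dots> = e5 1 * (\<Sum>s\<in>UNIV. e5 s)" by (simp add: e5_add sum_distrib_left mult.commute)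
  finally have "(e5 1 - 1) * (\<Sum>s\<in>UNIV. e5 s) = 0" by (simp add: algebra_simps)
  then show ?thesis by (simp add: e5_eq_1_iff)
qed

definition dot :: "nat \<Rightarrow> (nat \<Rightarrow> gf5) \<Rightarrow> (nat \<Rightarrow> gf5) \<Rightarrow> gf5" where
  "dot n \<gamma> x = (\<Sum>i<n. \<gamma> i * x i)"

lemma dot_add_right: "dot n \<gamma> (x + y) = dot n \<gamma> x + dot n \<gamma> y"
  by (simp add: dot_def algebra_simps sum.distrib)

lemma dot_diff_right: "dot n \<gamma> (x - y) = dot n \<gamma> x - dot n \<gamma> y"
  by (simp add: dot_def algebra_simps sum_subtractf)

lemma dot_add_left: "dot n (\<gamma> + \<delta>) x = dot n \<gamma> x + dot n \<delta> x"
  by (simp add: dot_def algebra_simps sum.distrib)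

lemma dot_scale_right: "dot n \<gamma> (F5_scale c x) = c * dot n \<gamma> x"
  by (simp add: dot_def F5_scale_def sum_distrib_left algebra_simps)

lemma dot_0_right [simp]: "dot n \<gamma> 0 = 0" by (simp add: dot_def)

text \<open>If \<open>x i\<close> is nonzero, translating the summation variable by the i-th unit
  vector multiplies the sum by \<open>e5 (x i)\<close>, which is not 1.\<close>

lemma sum_e5_dot:
  assumes x: "x \<in> F5_space n"
  shows "(\<Sum>\<gamma>\<in>F5_space n. e5 (dot n \<gamma> x)) = (if x = 0 then 5 ^ n else 0)"
proof (cases "x = 0")
  case True
  then show ?thesis by (simp add: card_F5_space)
next
  case False
  then obtain i where i: "x i \<noteq> 0" by (auto simp: fun_eq_iff)
  with x have "i < n" by (auto simp: F5_space_def not_le[symmetric])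
  define \<delta> :: "nat \<Rightarrow> gf5" where "\<delta> = (\<lambda>j. if j = i then 1 else 0)"
  have \<delta>: "\<delta> \<in> F5_space n" using \<open>i < n\<close> by (auto simp: \<delta>_def F5_space_def)
  have d: "dot n \<delta> x = x i"
    using \<open>i < n\<close> by (simp add: dot_def \<delta>_def if_distrib[of "\<lambda>c. c * _"] sum.delta cong: if_cong)
  have "(\<Sum>\<gamma>\<in>F5_space n. e5 (dot n \<gamma> x)) = (\<Sum>\<gamma>\<in>F5_space n. e5 (dot n (\<gamma> + \<delta>) x))"
    using F5_space.sum_translate[OF \<delta>, of "\<lambda>\<gamma>. e5 (dot n \<gamma> x)"] by simp
  also have "\<dots> = e5 (x i) * (\<Sum>\<gamma>\<in>F5_space n. e5 (dot n \<gamma> x))"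
    by (simp add: dot_add_left e5_add d sum_distrib_left mult.commute)
  finally have "(e5 (x i) - 1) * (\<Sum>\<gamma>\<in>F5_space n. e5 (dot n \<gamma> x)) = 0"
    by (simp add: algebra_simps)
  then show ?thesis using i False by (simp add: e5_eq_1_iff)
qed

section \<open>The unnormalised Fourier transform and its behaviour under smoothing\<close>

definition fourier :: "nat \<Rightarrow> ((nat \<Rightarrow> gf5) \<Rightarrow> real) \<Rightarrow> (nat \<Rightarrow> gf5) \<Rightarrow> complex" where
  "fourier n u \<gamma> = (\<Sum>x\<in>F5_space n. of_real (u x) * e5 (dot n \<gamma> x))"

lemma plancherel:
  "(\<Sum>\<gamma>\<in>F5_space n. (cmod (fourier n u \<gamma>))\<^sup>2) = 5 ^ n * (\<Sum>x\<in>F5_space n. (u x)\<^sup>2)"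
proof -
  let ?G = "F5_space n"
  have "complex_of_real (\<Sum>\<gamma>\<in>?G. (cmod (fourier n u \<gamma>))\<^sup>2) =
      (\<Sum>\<gamma>\<in>?G. fourier n u \<gamma> * cnj (fourier n u \<gamma>))"
    unfolding of_real_sum complex_norm_square ..
  also have "\<dots> = (\<Sum>\<gamma>\<in>?G. \<Sum>x\<in>?G. \<Sum>y\<in>?G. of_real (u x * u y) * e5 (dot n \<gamma> (x - y)))"
    unfolding fourier_def cnj_sum sum_product
    by (intro sum.cong refl)
      (simp add: dot_diff_right e5_add[of _ "- _", simplified] e5_minus)
  also have "\<dots> = (\<Sum>x\<in>?G. \<Sum>\<gamma>\<in>?G. \<Sum>y\<in>?G. of_real (u x * u y) * e5 (dot n \<gamma> (x - y)))"
    by (rule sum.swap)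
  also have "\<dots> = (\<Sum>x\<in>?G. \<Sum>y\<in>?G. \<Sum>\<gamma>\<in>?G. of_real (u x * u y) * e5 (dot n \<gamma> (x - y)))"
    by (intro sum.cong refl sum.swap)
  also have "\<dots> = (\<Sum>x\<in>?G. \<Sum>y\<in>?G. if y = x then of_real (u x * u y) * 5 ^ n else 0)"
    by (intro sum.cong refl)
      (simp add: sum_e5_dot F5_space.diff_mem flip: sum_distrib_left)
  also have "\<dots> = complex_of_real (5 ^ n * (\<Sum>x\<in>?G. (u x)\<^sup>2))"
    by (simp add: sum.delta finite_F5_space power2_eq_square sum_distrib_left mult.commute)
  finally show ?thesis by (simp only: of_real_eq_iff)
qed

lemma fourier_translate:
  assumes "v \<in> F5_space n"
  shows "fourier n (\<lambda>y. u (y + v)) \<gamma> = cnj (e5 (dot n \<gamma> v)) * fourier n u \<gamma>"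
proof -
  have "(\<Sum>x\<in>F5_space n. of_real (u x) * e5 (dot n \<gamma> (x - v))) =
     (\<Sum>x\<in>F5_space n. of_real (u (x + v)) * e5 (dot n \<gamma> (x + v - v)))"
    using F5_space.sum_translate[OF assms, of "\<lambda>x. of_real (u x) * e5 (dot n \<gamma> (x - v))"] by simp
  then show ?thesis
    by (simp add: fourier_def dot_diff_right e5_add[of _ "- _", simplified] e5_minus
        sum_distrib_left mult_ac)
qed

text \<open>Translation by \<open>t - s\<close> multiplies the transform by a character value, and
  the double sum over \<open>T\<close> factors as a number times its conjugate. For empty
  \<open>T\<close> both sides vanish under division by zero.\<close>

lemma fourier_smooth:
  assumes "T \<subseteq> F5_space n"
  shows "fourier n (smooth T u) \<gamma> =
    of_real ((cmod (\<Sum>t\<in>T. e5 (dot n \<gamma> t)) / card T)\<^sup>2) * fourier n u \<gamma>"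
proof -
  let ?G = "F5_space n" and ?w = "\<Sum>t\<in>T. e5 (dot n \<gamma> t)"
  have "fourier n (smooth T u) \<gamma> * of_real ((real (card T))\<^sup>2) * 1 =
     (\<Sum>x\<in>?G. \<Sum>t\<in>T. \<Sum>s\<in>T. of_real (u (x + t - s)) * e5 (dot n \<gamma> x))"
  proof (cases "card T = 0")
    case True
    then have "T = {}" using finite_subset[OF assms finite_F5_space] by simp
    then show ?thesis by simp
  next
    case False
    then have "smooth T u x * (real (card T))\<^sup>2 = (\<Sum>t\<in>T. \<Sum>s\<in>T. u (x + t - s))" for x
      by (simp add: smooth_def)
    then have "of_real (smooth T u x) * of_real ((real (card T))\<^sup>2) =
        (\<Sum>t\<in>T. \<Sum>s\<in>T. complex_of_real (u (x + t - s)))" for x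
      by (simp only: flip: of_real_mult of_real_sum)
    note eq = this[unfolded mult.commute[of _ "of_real ((real (card T))\<^sup>2)"]]
    show ?thesis
      unfolding fourier_def mult_1_right mult.commute[of _ "of_real ((real (card T))\<^sup>2)"]
        sum_distrib_left mult.assoc[symmetric] eq
      by (simp only: sum_distrib_right)
  qed
  also have "\<dots> = (\<Sum>t\<in>T. \<Sum>x\<in>?G. \<Sum>s\<in>T. of_real (u (x + t - s)) * e5 (dot n \<gamma> x))"
    by (rule sum.swap)
  also have "\<dots> = (\<Sum>t\<in>T. \<Sum>s\<in>T. \<Sum>x\<in>?G. of_real (u (x + t - s)) * e5 (dot n \<gamma> x))"
    by (intro sum.cong refl sum.swap)
  also have "\<dots> = (\<Sum>t\<in>T. \<Sum>s\<in>T. cnj (e5 (dot n \<gamma> t)) * e5 (dot n \<gamma> s) * fourier n u \<gamma>)"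
  proof (intro sum.cong refl)
    fix t s assume "t \<in> T" "s \<in> T"
    then have "t - s \<in> ?G" using assms F5_space.diff_mem by blast
    from fourier_translate[OF this, of u \<gamma>]
    show "(\<Sum>x\<in>?G. of_real (u (x + t - s)) * e5 (dot n \<gamma> x)) =
        cnj (e5 (dot n \<gamma> t)) * e5 (dot n \<gamma> s) * fourier n u \<gamma>"
      by (simp add: fourier_def[of n "\<lambda>y. u (y + t - s)"] dot_diff_right
          e5_add[of _ "- _", simplified] e5_minus add_diff_eq)
  qed
  also have "\<dots> = cnj ?w * ?w * fourier n u \<gamma>"
    unfolding cnj_sum sum_product by (simp add: sum_distrib_right)
  also have "\<dots> = of_real ((cmod ?w)\<^sup>2) * fourier n u \<gamma>"
    unfolding complex_norm_square by (simp only: mult.commute)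
  finally have eq: "fourier n (smooth T u) \<gamma> * of_real ((real (card T))\<^sup>2) =
    of_real ((cmod ?w)\<^sup>2) * fourier n u \<gamma>" by simp
  show ?thesis
  proof (cases "card T = 0")
    case True
    then show ?thesis by (simp add: fourier_def smooth_def)
  next
    case False
    then show ?thesis using eq by (simp add: power_divide field_simps)
  qed
qed

lemma fourier_smooth_iter:
  assumes "T \<subseteq> F5_space n"
  shows "fourier n ((smooth T ^^ k) u) \<gamma> =
    of_real ((cmod (\<Sum>t\<in>T. e5 (dot n \<gamma> t)) / card T) ^ (2 * k)) * fourier n u \<gamma>"
  by (induction k) (simp_all add: fourier_smooth[OF assms] power_add power2_eq_square)

text \<open>With threshold 1/2, one smoothing divides every Fourier coefficient outside this set by
  at least 4.\<close>

definition large_spectrum :: "nat \<Rightarrow> (nat \<Rightarrow> gf5) set \<Rightarrow> (nat \<Rightarrow> gf5) set" where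
  "large_spectrum n T = {\<gamma> \<in> F5_space n. card T / 2 \<le> cmod (\<Sum>t\<in>T. e5 (dot n \<gamma> t))}"

definition annihilator :: "nat \<Rightarrow> (nat \<Rightarrow> gf5) set \<Rightarrow> (nat \<Rightarrow> gf5) set" where
  "annihilator n \<Gamma> = {v \<in> F5_space n. \<forall>\<gamma>\<in>\<Gamma>. dot n \<gamma> v = 0}"

lemma fourier_diff: "fourier n (\<lambda>x. u x - v x) \<gamma> = fourier n u \<gamma> - fourier n v \<gamma>"
  by (simp add: fourier_def sum_subtractf algebra_simps)

text \<open>By Plancherel it suffices to bound each coefficient of the difference. It vanishes on
  the large spectrum, where the character is trivial on \<open>v\<close>; elsewhere the smoothings
  contribute \<open>1 / 4 ^ k\<close> and the translation at most 2.\<close>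

lemma smooth_iter_translate_L2:
  assumes T: "T \<subseteq> F5_space n" "T \<noteq> {}" and v: "v \<in> annihilator n (large_spectrum n T)"
  shows "(\<Sum>x\<in>F5_space n. ((smooth T ^^ k) u (x + v) - (smooth T ^^ k) u x)\<^sup>2) \<le>
    4 / 16 ^ k * (\<Sum>x\<in>F5_space n. (u x)\<^sup>2)"
proof -
  let ?G = "F5_space n"
  define U where "U = (\<lambda>x. (smooth T ^^ k) u (x + v) - (smooth T ^^ k) u x)"
  have finT: "finite T" using T finite_F5_space finite_subset by blast
  have cT: "0 < real (card T)" using finT T by (simp add: card_gt_0_iff)
  have vG: "v \<in> ?G" using v by (simp add: annihilator_def)
  have bound: "cmod (fourier n U \<gamma>) \<le> 2 / 4 ^ k * cmod (fourier n u \<gamma>)" if \<gamma>: "\<gamma> \<in> ?G" for \<gamma>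
  proof -
    let ?r = "cmod (\<Sum>t\<in>T. e5 (dot n \<gamma> t)) / card T"
    have "fourier n U \<gamma> = of_real (?r ^ (2 * k)) * (cnj (e5 (dot n \<gamma> v)) - 1) * fourier n u \<gamma>"
      unfolding U_def fourier_diff fourier_translate[OF vG] fourier_smooth_iter[OF T(1)]
      by (simp only: algebra_simps) simp
    then have U: "cmod (fourier n U \<gamma>) =
        ?r ^ (2 * k) * cmod (cnj (e5 (dot n \<gamma> v)) - 1) * cmod (fourier n u \<gamma>)"
      by (simp only: norm_mult norm_of_real) simp
    show ?thesis
    proof (cases "\<gamma> \<in> large_spectrum n T")
      case True
      then have "dot n \<gamma> v = 0" using v by (simp add: annihilator_def)
      then show ?thesis using U by simp
    next
      case False
      then have "?r \<le> 1 / 2" using \<gamma> cT by (simp add: large_spectrum_def field_simps)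
      then have "?r ^ (2 * k) \<le> (1 / 2) ^ (2 * k)" by (intro power_mono) auto
      also have "\<dots> = 1 / 4 ^ k" by (simp add: power_mult power_divide power_one_over)
      finally have r: "?r ^ (2 * k) \<le> 1 / 4 ^ k" .
      have "cmod (cnj (e5 (dot n \<gamma> v)) - 1) \<le> 2"
        using norm_triangle_ineq4[of "cnj (e5 (dot n \<gamma> v))" 1] by simp
      with r have "?r ^ (2 * k) * cmod (cnj (e5 (dot n \<gamma> v)) - 1) \<le> 1 / 4 ^ k * 2"
        by (intro mult_mono) auto
      then show ?thesis unfolding U by (intro mult_right_mono) auto
    qed
  qed
  have "5 ^ n * (\<Sum>x\<in>?G. (U x)\<^sup>2) = (\<Sum>\<gamma>\<in>?G. (cmod (fourier n U \<gamma>))\<^sup>2)"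
    by (simp add: plancherel)
  also have "\<dots> \<le> (\<Sum>\<gamma>\<in>?G. (2 / 4 ^ k * cmod (fourier n u \<gamma>))\<^sup>2)"
    by (intro sum_mono power_mono bound) auto
  also have "\<dots> = 5 ^ n * (4 / 16 ^ k * (\<Sum>x\<in>?G. (u x)\<^sup>2))"
    unfolding power_mult_distrib sum_distrib_left[symmetric] plancherel
    by (simp add: power_divide power_mult[symmetric] mult.commute[of _ 2] power_mult)
  finally have "(\<Sum>x\<in>?G. (U x)\<^sup>2) \<le> 4 / 16 ^ k * (\<Sum>x\<in>?G. (u x)\<^sup>2)"
    by (rule mult_left_le_imp_le) simp
  then show ?thesis by (simp only: U_def)
qed

text \<open>Cauchy-Schwarz over \<open>B\<close> bounds the squared difference by a sum of squares
  over the whole space divided by \<open>card B\<close>, to which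
  \<open>smooth_iter_translate_L2\<close> applies.\<close>

lemma smooth_iter_mean_over_translate:
  assumes T: "T \<subseteq> F5_space n" "T \<noteq> {}" and v: "v \<in> annihilator n (large_spectrum n T)"
    and B: "B \<subseteq> F5_space n" "B \<noteq> {}" and u: "\<And>x. 0 \<le> u x \<and> u x \<le> 1"
    and x: "x \<in> F5_space n"
  shows "((smooth T ^^ k) (mean_over B u) (x + v) - (smooth T ^^ k) (mean_over B u) x)\<^sup>2 \<le>
    4 / 16 ^ k * 5 ^ n / card B"
proof -
  let ?G = "F5_space n"
  define U where "U = (\<lambda>x. (smooth T ^^ k) u (x + v) - (smooth T ^^ k) u x)"
  have finB: "finite B" using B finite_F5_space finite_subset by blast
  have cB: "0 < real (card B)" using finB B by (simp add: card_gt_0_iff)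
  have "(smooth T ^^ k) (mean_over B u) (x + v) - (smooth T ^^ k) (mean_over B u) x =
      (\<Sum>b\<in>B. U (x - b)) / card B"
    by (simp add: smooth_iter_mean_over mean_over_def U_def sum_subtractf diff_divide_distrib algebra_simps)
  then have "((smooth T ^^ k) (mean_over B u) (x + v) - (smooth T ^^ k) (mean_over B u) x)\<^sup>2 =
      (\<Sum>b\<in>B. U (x - b))\<^sup>2 / (real (card B))\<^sup>2" by (simp add: power_divide)
  also have "\<dots> \<le> (\<Sum>b\<in>B. (U (x - b))\<^sup>2) * card B / (real (card B))\<^sup>2"
    by (intro divide_right_mono sum_squared_le_sum_of_squares) auto
  also have "\<dots> = (\<Sum>b\<in>B. (U (x - b))\<^sup>2) / card B" by (simp add: power2_eq_square)
  also have "\<dots> \<le> (\<Sum>b\<in>?G. (U (x - b))\<^sup>2) / card B"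
    using B finite_F5_space by (intro divide_right_mono sum_mono2) auto
  also have "(\<Sum>b\<in>?G. (U (x - b))\<^sup>2) = (\<Sum>y\<in>?G. (U y)\<^sup>2)"
    by (rule F5_space.sum_reflect[OF x])
  also have "\<dots> / card B \<le> (4 / 16 ^ k * (\<Sum>x\<in>?G. (u x)\<^sup>2)) / card B"
    unfolding U_def using smooth_iter_translate_L2[OF T v] by (intro divide_right_mono) auto
  also have "\<dots> \<le> (4 / 16 ^ k * (\<Sum>x\<in>?G. 1)) / card B"
    using u by (intro divide_right_mono mult_left_mono sum_mono) (auto simp: abs_square_le_1)
  also have "\<dots> = 4 / 16 ^ k * 5 ^ n / card B" by (simp add: card_F5_space)
  finally show ?thesis .
qed

section \<open>The large spectrum\<close>

text \<open>The injection records the value of the new character, one of five, and the projection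
  along \<open>w\<close> to its kernel.\<close>

lemma card_annihilator_le:
  assumes w: "w \<in> annihilator n \<Gamma>" "dot n \<gamma> w \<noteq> 0"
  shows "card (annihilator n \<Gamma>) \<le> 5 * card (annihilator n (insert \<gamma> \<Gamma>))"
proof -
  define p where "p = (\<lambda>x. x - F5_scale (dot n \<gamma> x / dot n \<gamma> w) w)"
  have fin: "finite (annihilator n \<Delta>)" for \<Delta>
    by (rule finite_subset[OF _ finite_F5_space[of n]]) (auto simp: annihilator_def)
  have "card (annihilator n \<Gamma>) \<le> card ((UNIV :: gf5 set) \<times> annihilator n (insert \<gamma> \<Gamma>))"
  proof (rule card_inj_on_le[where f = "\<lambda>x. (dot n \<gamma> x, p x)"])
    show "inj_on (\<lambda>x. (dot n \<gamma> x, p x)) (annihilator n \<Gamma>)"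
      by (rule inj_onI) (auto simp: p_def)
    show "(\<lambda>x. (dot n \<gamma> x, p x)) ` annihilator n \<Gamma> \<subseteq> UNIV \<times> annihilator n (insert \<gamma> \<Gamma>)"
    proof (rule image_subsetI)
      fix x assume x: "x \<in> annihilator n \<Gamma>"
      have "F5_scale c w \<in> F5_space n" for c
        using w by (auto simp: annihilator_def F5_space_def F5_scale_def)
      then have "p x \<in> F5_space n"
        using x F5_space.diff_mem by (simp add: p_def annihilator_def)
      moreover have "dot n \<delta> (p x) = 0" if "\<delta> \<in> insert \<gamma> \<Gamma>" for \<delta>
        using that x w by (auto simp: p_def annihilator_def dot_diff_right dot_scale_right)
      ultimately show "(dot n \<gamma> x, p x) \<in> UNIV \<times> annihilator n (insert \<gamma> \<Gamma>)"
        by (simp add: annihilator_def)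
    qed
    show "finite ((UNIV :: gf5 set) \<times> annihilator n (insert \<gamma> \<Gamma>))" using fin by simp
  qed
  then show ?thesis by (simp add: card_cartesian_product)
qed

text \<open>
  Stands in for the independence of characters: averaging over the shifts \<open>x + c w\<close> makes \<open>dot n \<gamma> x\<close>
  uniform while \<open>\<Phi> x\<close> stays fixed.
\<close>
lemma sum_mult_independent_le:
  assumes w: "w \<in> F5_space n" "dot n \<gamma> w \<noteq> 0"
    and inv: "\<And>x c. \<Phi> (x + F5_scale c w) = \<Phi> x" and pos: "\<And>x. 0 \<le> \<Phi> x"
    and \<psi>: "(\<Sum>s\<in>UNIV. \<psi> s) \<le> 5 * K"
  shows "(\<Sum>x\<in>F5_space n. \<Phi> x * \<psi> (dot n \<gamma> x)) \<le> K * (\<Sum>x\<in>F5_space n. \<Phi> x :: real)"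
proof -
  let ?G = "F5_space n"
  have "5 * (\<Sum>x\<in>?G. \<Phi> x * \<psi> (dot n \<gamma> x)) = (\<Sum>c\<in>(UNIV :: gf5 set). \<Sum>x\<in>?G. \<Phi> x * \<psi> (dot n \<gamma> x))"
    by simp
  also have "\<dots> = (\<Sum>c\<in>UNIV. \<Sum>x\<in>?G. \<Phi> x * \<psi> (dot n \<gamma> x + c * dot n \<gamma> w))"
  proof (rule sum.cong[OF refl])
    fix c :: gf5
    have "F5_scale c w \<in> ?G" using w by (auto simp: F5_space_def F5_scale_def)
    from F5_space.sum_translate[OF this, of "\<lambda>x. \<Phi> x * \<psi> (dot n \<gamma> x)"]
    show "(\<Sum>x\<in>?G. \<Phi> x * \<psi> (dot n \<gamma> x)) = (\<Sum>x\<in>?G. \<Phi> x * \<psi> (dot n \<gamma> x + c * dot n \<gamma> w))"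
      by (simp only: inv dot_add_right dot_scale_right)
  qed
  also have "\<dots> = (\<Sum>x\<in>?G. \<Phi> x * (\<Sum>c\<in>UNIV. \<psi> (dot n \<gamma> x + c * dot n \<gamma> w)))"
    unfolding sum_distrib_left by (rule sum.swap)
  also have "\<dots> = (\<Sum>x\<in>?G. \<Phi> x * (\<Sum>s\<in>UNIV. \<psi> s))"
  proof (rule sum.cong[OF refl])
    fix x
    have "(\<Sum>c\<in>UNIV. \<psi> (dot n \<gamma> x + c * dot n \<gamma> w)) = (\<Sum>s\<in>UNIV. \<psi> s)"
      using w(2)
      by (intro sum.reindex_bij_witness[of _ "\<lambda>s. (s - dot n \<gamma> x) / dot n \<gamma> w"
            "\<lambda>c. dot n \<gamma> x + c * dot n \<gamma> w"]) auto
    then show "\<Phi> x * (\<Sum>c\<in>UNIV. \<psi> (dot n \<gamma> x + c * dot n \<gamma> w)) = \<Phi> x * (\<Sum>s\<in>UNIV. \<psi> s)"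
      by (simp only:)
  qed
  also have "\<dots> \<le> (\<Sum>x\<in>?G. \<Phi> x * (5 * K))"
    by (intro sum_mono mult_left_mono \<psi> pos)
  also have "\<dots> = 5 * (K * (\<Sum>x\<in>?G. \<Phi> x))"
    by (simp add: sum_distrib_left mult_ac)
  finally show ?thesis by simp
qed

text \<open>
  Chang's theorem. Characters are added to \<open>\<Gamma>\<close> greedily while they are non-trivial on the
  annihilator of \<open>\<Gamma>\<close>; comparing the exponential moment \<open>\<Phi>\<close> on \<open>T\<close> and on the whole space bounds the
  number of steps.
\<close>
lemma annihilator_large_spectrum:
  assumes T: "T \<subseteq> F5_space n" "T \<noteq> {}"
  obtains r :: nat where "5 ^ n \<le> 5 ^ r * card (annihilator n (large_spectrum n T))"
    "exp (r / 16) * card T \<le> 5 ^ n"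
proof -
  let ?G = "F5_space n"
  have finT: "finite T" using T finite_F5_space finite_subset by blast
  have cT: "0 < real (card T)" using finT T by (simp add: card_gt_0_iff)
  define w where "w = (\<lambda>\<gamma>. \<Sum>t\<in>T. e5 (dot n \<gamma> t))"
  \<comment> \<open>This phase rotates the character so that its sum over \<open>T\<close> becomes
    the real number \<open>cmod (w \<gamma>)\<close>.\<close>
  define ph where "ph = (\<lambda>\<gamma>. cnj (w \<gamma>) / cmod (w \<gamma>))"
  define \<phi> where "\<phi> = (\<lambda>\<gamma> x. Re (ph \<gamma> * e5 (dot n \<gamma> x)))"
  \<comment> \<open>With the factor 1/4, each character costs exp ((1/4)^2) = exp (1/16) over the
    whole space. On \<open>T\<close> its mean is at least 1/2, which adds 1/8 to the exponent; the
    surplus of 1/16 limits the number of characters.\<close>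
  define \<Phi> where "\<Phi> = (\<lambda>\<Gamma> x. exp ((\<Sum>\<gamma>\<in>\<Gamma>. \<phi> \<gamma> x) / 4))"
  define good where "good = (\<lambda>\<Gamma>. \<Gamma> \<subseteq> large_spectrum n T \<and> 5 ^ n \<le> 5 ^ card \<Gamma> * card (annihilator n \<Gamma>) \<and>
    (\<Sum>x\<in>?G. \<Phi> \<Gamma> x) \<le> exp (card \<Gamma> / 16) * 5 ^ n)"
  have fin_spec: "finite (large_spectrum n T)"
    by (rule finite_subset[OF _ finite_F5_space[of n]]) (auto simp: large_spectrum_def)
  have ph: "cmod (ph \<gamma>) \<le> 1" for \<gamma> by (simp add: ph_def norm_divide)
  have "good {}" by (simp add: good_def \<Phi>_def annihilator_def card_F5_space)
  moreover have "finite {\<Gamma>. good \<Gamma>}"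
    by (rule finite_subset[of _ "Pow (large_spectrum n T)"]) (auto simp: good_def fin_spec)
  ultimately obtain \<Gamma> where \<Gamma>: "good \<Gamma>" and max: "\<And>\<Delta>. good \<Delta> \<Longrightarrow> \<Gamma> \<subseteq> \<Delta> \<Longrightarrow> \<Gamma> = \<Delta>"
    using finite_has_maximal2[of "{\<Gamma>. good \<Gamma>}" "{}"] by auto
  have fin\<Gamma>: "finite \<Gamma>" using \<Gamma> fin_spec finite_subset by (auto simp: good_def)
  \<comment> \<open>Otherwise \<open>\<gamma>\<close> could be added to the maximal set
    \<open>\<Gamma>\<close>, with \<open>v\<close> as the direction of the independence
    averaging.\<close>
  have zero: "dot n \<gamma> v = 0" if \<gamma>: "\<gamma> \<in> large_spectrum n T" and v: "v \<in> annihilator n \<Gamma>" for \<gamma> v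
  proof (rule ccontr)
    assume nz: "dot n \<gamma> v \<noteq> 0"
    have "\<gamma> \<notin> \<Gamma>" using nz v by (auto simp: annihilator_def)
    have "good (insert \<gamma> \<Gamma>)"
      unfolding good_def
    proof (intro conjI)
      show "insert \<gamma> \<Gamma> \<subseteq> large_spectrum n T" using \<Gamma> \<gamma> by (simp add: good_def)
      have "5 ^ n \<le> 5 ^ card \<Gamma> * card (annihilator n \<Gamma>)" using \<Gamma> by (simp add: good_def)
      also have "\<dots> \<le> 5 ^ card \<Gamma> * (5 * card (annihilator n (insert \<gamma> \<Gamma>)))"
        by (intro mult_left_mono card_annihilator_le[OF v nz]) auto
      finally show "5 ^ n \<le> 5 ^ card (insert \<gamma> \<Gamma>) * card (annihilator n (insert \<gamma> \<Gamma>))"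
        using fin\<Gamma> \<open>\<gamma> \<notin> \<Gamma>\<close> by simp
      define \<psi> where "\<psi> = (\<lambda>s. exp (1 / 4 * Re (ph \<gamma> * e5 s)))"
      have "(\<Sum>s\<in>UNIV. \<psi> s) \<le> real (card (UNIV :: gf5 set)) * exp ((1 / 4)\<^sup>2)"
        unfolding \<psi>_def
      proof (rule sum_exp_mean_zero_le)
        show "\<bar>Re (ph \<gamma> * e5 b)\<bar> \<le> 1" for b
          using abs_Re_le_cmod[of "ph \<gamma> * e5 b"] ph[of \<gamma>] by (simp add: norm_mult)
        have "(\<Sum>b\<in>UNIV. ph \<gamma> * e5 b) = 0"
          by (simp add: sum_e5 flip: sum_distrib_left)
        then show "(\<Sum>b\<in>UNIV. Re (ph \<gamma> * e5 b)) = 0"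
          by (simp only: flip: Re_sum) simp
      qed simp
      then have \<psi>: "(\<Sum>s\<in>UNIV. \<psi> s) \<le> 5 * exp (1 / 16)"
        by (simp add: power2_eq_square)
      have "(\<Sum>x\<in>?G. \<Phi> (insert \<gamma> \<Gamma>) x) = (\<Sum>x\<in>?G. \<Phi> \<Gamma> x * \<psi> (dot n \<gamma> x))"
        unfolding \<Phi>_def \<psi>_def exp_add[symmetric] using fin\<Gamma> \<open>\<gamma> \<notin> \<Gamma>\<close>
        by (intro sum.cong refl arg_cong[where f = exp]) (simp add: \<phi>_def add_divide_distrib)
      also have "\<dots> \<le> exp (1 / 16) * (\<Sum>x\<in>?G. \<Phi> \<Gamma> x)"
      proof (rule sum_mult_independent_le[where w = v])
        show "v \<in> ?G" using v by (simp add: annihilator_def)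
        show "\<Phi> \<Gamma> (x + F5_scale c v) = \<Phi> \<Gamma> x" for x c
          unfolding \<Phi>_def \<phi>_def using v
          by (intro arg_cong[where f = exp] arg_cong2[where f = "(/)"] sum.cong refl)
            (simp add: dot_add_right dot_scale_right annihilator_def)
      qed (use nz \<psi> in \<open>auto simp: \<Phi>_def\<close>)
      also have "\<dots> \<le> exp (1 / 16) * (exp (card \<Gamma> / 16) * 5 ^ n)"
        using \<Gamma> by (intro mult_left_mono) (auto simp: good_def)
      also have "\<dots> = exp (card (insert \<gamma> \<Gamma>) / 16) * 5 ^ n"
        using fin\<Gamma> \<open>\<gamma> \<notin> \<Gamma>\<close> by (simp add: add_divide_distrib flip: exp_add mult.assoc)
      finally show "(\<Sum>x\<in>?G. \<Phi> (insert \<gamma> \<Gamma>) x) \<le> exp (card (insert \<gamma> \<Gamma>) / 16) * 5 ^ n" .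
    qed
    then show False using max[of "insert \<gamma> \<Gamma>"] \<open>\<gamma> \<notin> \<Gamma>\<close> by blast
  qed
  have eq: "annihilator n \<Gamma> = annihilator n (large_spectrum n T)"
  proof
    show "annihilator n \<Gamma> \<subseteq> annihilator n (large_spectrum n T)" using zero by (auto simp: annihilator_def)
    show "annihilator n (large_spectrum n T) \<subseteq> annihilator n \<Gamma>" using \<Gamma> by (auto simp: annihilator_def good_def)
  qed
  let ?r = "card \<Gamma>"
  have lower: "exp (?r / 8) * card T \<le> (\<Sum>x\<in>T. \<Phi> \<Gamma> x)"
  proof -
    define S where "S = (\<lambda>t. (\<Sum>\<gamma>\<in>\<Gamma>. \<phi> \<gamma> t) / 4)"
    have "(\<Sum>t\<in>T. \<phi> \<gamma> t) \<ge> card T / 2" if "\<gamma> \<in> \<Gamma>" for \<gamma>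
    proof -
      have "(\<Sum>t\<in>T. \<phi> \<gamma> t) = Re (ph \<gamma> * w \<gamma>)"
        by (simp only: \<phi>_def w_def sum_distrib_left Re_sum)
      also have "ph \<gamma> * w \<gamma> = of_real (cmod (w \<gamma>))"
        by (simp add: ph_def complex_norm_square[symmetric] mult.commute power2_eq_square)
      finally show ?thesis using that \<Gamma> by (auto simp: good_def large_spectrum_def w_def)
    qed
    then have "(\<Sum>\<gamma>\<in>\<Gamma>. real (card T) / 2) \<le> (\<Sum>\<gamma>\<in>\<Gamma>. \<Sum>t\<in>T. \<phi> \<gamma> t)" by (intro sum_mono)
    also have "\<dots> = 4 * (\<Sum>t\<in>T. S t)"
      unfolding S_def sum_divide_distrib[symmetric] by (simp add: sum.swap[of _ \<Gamma>])
    finally have S: "card T * (?r / 8) \<le> (\<Sum>t\<in>T. S t)" by (simp add: field_simps)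
    \<comment> \<open>Jensen's inequality for the exponential, proved through its tangent line at
      \<open>?r / 8\<close>, a lower bound for the mean of \<open>S\<close> on
      \<open>T\<close>.\<close>
    have "exp (?r / 8) * card T \<le> (\<Sum>t\<in>T. exp (?r / 8) * (1 + (S t - ?r / 8)))"
      using S unfolding sum_distrib_left[symmetric]
      by (intro mult_left_mono) (simp_all add: sum.distrib sum_subtractf algebra_simps)
    also have "\<dots> \<le> (\<Sum>t\<in>T. exp (?r / 8) * exp (S t - ?r / 8))"
      by (intro sum_mono mult_left_mono exp_ge_add_one_self) auto
    also have "\<dots> = (\<Sum>t\<in>T. \<Phi> \<Gamma> t)" by (simp add: \<Phi>_def S_def flip: exp_add)
    finally show ?thesis .
  qed
  also have "\<dots> \<le> (\<Sum>x\<in>?G. \<Phi> \<Gamma> x)"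
    using T finite_F5_space by (intro sum_mono2) (auto simp: \<Phi>_def)
  also have "\<dots> \<le> exp (?r / 16) * 5 ^ n" using \<Gamma> by (simp add: good_def)
  also have "exp (?r / 8) = exp (?r / 16) * exp (?r / 16)" by (simp flip: exp_add)
  finally have "exp (?r / 16) * (exp (?r / 16) * card T) \<le> exp (?r / 16) * 5 ^ n"
    by (simp only: mult.assoc)
  then have "exp (?r / 16) * card T \<le> 5 ^ n" by (rule mult_left_le_imp_le) simp
  moreover have "5 ^ n \<le> 5 ^ ?r * card (annihilator n (large_spectrum n T))"
    using \<Gamma> eq by (simp add: good_def)
  ultimately show ?thesis using that[of ?r] by blast
qed

section \<open>Cardinality and dimension of subspaces\<close>

lemma subspace_annihilator: "F5.subspace (annihilator n \<Gamma>)"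
proof (rule F5.subspaceI)
  show "0 \<in> annihilator n \<Gamma>" using F5_space.zero_mem by (simp add: annihilator_def)
  show "x + y \<in> annihilator n \<Gamma>" if "x \<in> annihilator n \<Gamma>" "y \<in> annihilator n \<Gamma>" for x y
    using that F5_space.add_mem by (simp add: annihilator_def dot_add_right)
  show "F5_scale c x \<in> annihilator n \<Gamma>" if "x \<in> annihilator n \<Gamma>" for c x
    using that by (simp add: annihilator_def dot_scale_right) (simp add: F5_space_def F5_scale_def)
qed

lemma card_F5_span_le:
  assumes "finite B"
  shows "finite (F5.span B) \<and> card (F5.span B) \<le> 5 ^ card B"
  using assms
proof (induction B)
  case empty
  then show ?case by simp
next
  case (insert b B)
  let ?f = "\<lambda>(c, y). F5_scale c b + y" and ?P = "(UNIV :: gf5 set) \<times> F5.span B"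
  have "F5.span (insert b B) \<subseteq> ?f ` ?P"
  proof
    fix x assume "x \<in> F5.span (insert b B)"
    then obtain c where "x - F5_scale c b \<in> F5.span B" by (auto simp: F5.span_insert)
    then show "x \<in> ?f ` ?P" by (intro image_eqI[of _ _ "(c, x - F5_scale c b)"]) auto
  qed
  moreover have "finite ?P" using insert.IH by simp
  ultimately have "finite (F5.span (insert b B))" "card (F5.span (insert b B)) \<le> card ?P"
    by (auto intro: finite_subset surj_card_le)
  moreover have "card ?P \<le> 5 ^ card (insert b B)"
    using insert by (simp add: card_cartesian_product)
  ultimately show ?case by linarith
qed

text \<open>The upper bound on the size of a span forces a basis of \<open>V\<close> to have at
  least \<open>d\<close> elements; \<open>d\<close> of them span \<open>W\<close>, and the same
  bound limits its size.\<close>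

lemma F5_subspace_of_dim_exists:
  assumes "F5.subspace V" "finite V" "5 ^ d \<le> card V"
  obtains W where "W \<subseteq> V" "F5.subspace W" "F5.dim W = d" "finite W" "card W \<le> 5 ^ d"
proof -
  obtain B where B: "B \<subseteq> V" "F5.independent B" "V \<subseteq> F5.span B" "card B = F5.dim V"
    using F5.basis_exists by blast
  have finB: "finite B" using B(1) assms(2) finite_subset by blast
  have "5 ^ d \<le> card V" by fact
  also have "\<dots> \<le> card (F5.span B)"
    using card_F5_span_le[OF finB] B(3) by (intro card_mono) auto
  also have "\<dots> \<le> 5 ^ card B" using card_F5_span_le[OF finB] by simp
  finally have "d \<le> card B" by simp
  then obtain C where C: "C \<subseteq> B" "card C = d" "finite C"
    by (meson obtain_subset_with_card_n)
  show ?thesis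
  proof (rule that[of "F5.span C"])
    show "F5.span C \<subseteq> V" using C(1) B(1) assms(1) by (intro F5.span_minimal) auto
    have "F5.independent C" using B(2) C(1) by (rule F5.independent_mono)
    then show "F5.dim (F5.span C) = d" using F5.dim_span_eq_card_independent C(2) by metis
  qed (use card_F5_span_le[OF C(3)] C(2) in auto)
qed

section \<open>Subspaces of triple sumsets\<close>

text \<open>Each pair of elements of \<open>A\<close> is counted for exactly one \<open>y\<close>,
  its sum, so the total over \<open>y\<close> is \<open>(card A)\<^sup>2\<close>; some
  \<open>y\<close> reaches the average.\<close>

lemma (in finite_subgroup) exists_symmetric_part:
  assumes A: "A \<subseteq> G"
  obtains y where "y \<in> G" "(card A)\<^sup>2 \<le> card G * card {x \<in> A. y - x \<in> A}"
proof -
  have finA: "finite A" using A finite_carrier finite_subset by blast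
  have "(\<Sum>y\<in>G. card {x \<in> A. y - x \<in> A}) = (\<Sum>x\<in>A. card {y \<in> G. y - x \<in> A})"
    by (rule sum_card_swap[OF finite_carrier finA])
  also have "\<dots> = (\<Sum>x\<in>A. card A)"
  proof (rule sum.cong[OF refl])
    fix x assume "x \<in> A"
    then show "card {y \<in> G. y - x \<in> A} = card A"
      using A add_mem
      by (intro bij_betw_same_card[of "\<lambda>y. y - x"] bij_betwI[where g = "\<lambda>a. a + x"]) auto
  qed
  also have "\<dots> = (card A)\<^sup>2" by (simp add: power2_eq_square)
  finally have sum: "(\<Sum>y\<in>G. card {x \<in> A. y - x \<in> A}) = (card A)\<^sup>2" .
  have "\<exists>y\<in>G. (card A)\<^sup>2 \<le> card G * card {x \<in> A. y - x \<in> A}"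
  proof (rule ccontr)
    assume "\<not> ?thesis"
    then have "(\<Sum>y\<in>G. card G * card {x \<in> A. y - x \<in> A}) < (\<Sum>y\<in>G. (card A)\<^sup>2)"
      using finite_carrier zero_mem by (intro sum_strict_mono) (auto simp: not_le)
    then show False by (simp add: sum flip: sum_distrib_left)
  qed
  then show ?thesis using that by blast
qed

text \<open>
  The factor \<open>5 ^ d\<close> in \<open>small\<close> pays for the union bound over a \<open>d\<close>-dimensional subspace, and \<open>dims\<close>
  leaves room for such a subspace in the annihilator of the large spectrum.
\<close>
lemma affine_subspace_in_triple_sum:
  fixes \<alpha> :: real and k m d :: nat
  assumes A: "A \<subseteq> F5_space n" and cardA: "real (card A) \<ge> \<alpha> * 5 ^ n" and \<alpha>: "0 < \<alpha>"
    and k: "8 / \<alpha> \<le> 4 ^ k" "0 < k" and m: "0 < m"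
    and small: "64 * k * 5 ^ d * exp (- (m / (1024 * k\<^sup>2))) < \<alpha>"
    and dims: "16 * (ln 2 + 2 * m * ln (1 / \<alpha>)) + d \<le> n"
  shows "\<exists>S. affine_subspace_of_dim n d S \<and> S \<subseteq> A + A + A"
proof -
  let ?G = "F5_space n"
  define N :: real where "N = 5 ^ n"
  have N: "N > 0" "real (card ?G) = N" by (simp_all add: N_def card_F5_space)
  have finA: "finite A" using A finite_F5_space finite_subset by blast
  obtain y where y: "y \<in> ?G" "(card A)\<^sup>2 \<le> card ?G * card {x \<in> A. y - x \<in> A}"
    using F5_space.exists_symmetric_part[OF A] by blast
  define B where "B = {x \<in> A. y - x \<in> A}"
  have "(\<alpha> * N)\<^sup>2 \<le> (real (card A))\<^sup>2"
    using cardA \<alpha> N by (intro power_mono) (auto simp: N_def)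
  also have "\<dots> \<le> N * card B"
    using y(2) unfolding N(2)[symmetric] B_def by (simp only: flip: of_nat_power of_nat_mult of_nat_le_iff)
  finally have "N * (\<alpha>\<^sup>2 * N) \<le> N * card B" by (simp add: power2_eq_square mult_ac)
  then have cardB: "\<alpha>\<^sup>2 * N \<le> card B" using N by (simp add: mult_le_cancel_left_pos)
  moreover have "0 < \<alpha>\<^sup>2 * N" using \<alpha> N by simp
  ultimately have cB: "0 < real (card B)" by linarith
  have B: "B \<subseteq> ?G" "B \<noteq> {}" using A cB by (force simp: B_def, force)
  define u :: "(nat \<Rightarrow> gf5) \<Rightarrow> real" where "u = (\<lambda>x. of_bool (x \<in> A + A))"
  have u: "0 \<le> u x \<and> u x \<le> 1" for x by (simp add: u_def)
  define f where "f = mean_over B u"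
  have f: "0 \<le> f x \<and> f x \<le> 1" for x
    unfolding f_def using finA B(2) u by (intro mean_over_bounds) (auto simp: B_def)
  \<comment> \<open>For \<open>b\<close> in \<open>B\<close> also \<open>y - b\<close> lies in
    \<open>A\<close>, so y + a - b = a + (y - b) is in \<open>A + A\<close>. Hence \<open>f\<close>
    equals 1 on this translate of \<open>A\<close>.\<close>
  define X where "X = (\<lambda>a. y + a) ` A"
  have X: "X \<subseteq> ?G" "card X = card A"
    using A y(1) F5_space.add_mem by (auto simp: X_def card_image)
  have fX: "f x = 1" if x: "x \<in> X" for x
  proof -
    obtain a where a: "a \<in> A" "x = y + a" using x by (auto simp: X_def)
    have "u (x - b) = 1" if "b \<in> B" for b
    proof -
      have "a + (y - b) \<in> A + A" using a(1) that by (intro set_plus_intro) (auto simp: B_def)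
      then show ?thesis by (simp add: u_def a(2) algebra_simps)
    qed
    then show ?thesis using cB by (simp add: f_def mean_over_def)
  qed
  have fpos: "x \<in> A + A + A" if "f x > 0" for x
  proof -
    have "\<exists>b\<in>B. x - b \<in> A + A"
    proof (rule ccontr)
      assume "\<not> ?thesis"
      then have "f x = 0" by (simp add: f_def mean_over_def u_def)
      then show False using that by simp
    qed
    then obtain b where b: "b \<in> B" "x - b \<in> A + A" by blast
    then have "(x - b) + b \<in> A + A + A" by (intro set_plus_intro) (auto simp: B_def)
    then show ?thesis by simp
  qed
  \<comment> \<open>Chosen so that \<open>k\<close> smoothings move \<open>f\<close> by at most 1/8,
    apart from the error function \<open>h\<close>.\<close>
  define \<epsilon> :: real where "\<epsilon> = 1 / (16 * k)"
  have \<epsilon>: "0 \<le> \<epsilon>" "\<epsilon> \<le> 1" "2 * real k * \<epsilon> = 1 / 8" using k(2) by (simp_all add: \<epsilon>_def)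
  define E where "E = exp (- (m / (1024 * k\<^sup>2)))"
  have E: "exp (- \<epsilon>\<^sup>2 * m / 4) = E" by (simp add: E_def \<epsilon>_def power_divide power_mult_distrib)
  from F5_space.exists_almost_periods[where u = u, OF B u \<epsilon>(1,2) m, unfolded E N(2) f_def[symmetric]]
  obtain T g where T: "T \<subseteq> ?G" "T \<noteq> {}" "real (card B) ^ m * N \<le> 2 * card T * N ^ m"
    and bad: "\<forall>t\<in>T. real (card {x \<in> ?G. \<epsilon> < \<bar>f (x + t) - g x\<bar>}) \<le> 4 * E * N"
    by (elim exE conjE)
  define F where "F = (smooth T ^^ k) f"
  from F5_space.smooth_iter_approx[OF T(1,2) f \<epsilon>(1) bad[rule_format], of k, folded F_def, unfolded \<epsilon>(3)]
  obtain h where "(\<forall>x. 0 \<le> h x) \<and> (\<forall>x\<in>?G. \<bar>F x - f x\<bar> \<le> 1 / 8 + h x) \<and>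
    (\<Sum>x\<in>?G. h x) \<le> 2 * real k * (4 * E * N)" ..
  then have h: "0 \<le> h x" "x \<in> ?G \<Longrightarrow> \<bar>F x - f x\<bar> \<le> 1 / 8 + h x"
    "(\<Sum>x\<in>?G. h x) \<le> 2 * real k * (4 * E * N)" for x
    by simp_all
  obtain r where r: "5 ^ n \<le> 5 ^ r * card (annihilator n (large_spectrum n T))" "exp (real r / 16) * card T \<le> 5 ^ n"
    using annihilator_large_spectrum[OF T(1,2)] by blast
  \<comment> \<open>The almost-period bound gives \<open>card T\<close> at least
    \<open>\<alpha> ^ (2 * m) * N / 2\<close>, so Chang's theorem bounds the codimension
    \<open>r\<close> by the first summand in \<open>dims\<close>.\<close>
  have "r + d \<le> n"
  proof -
    have "(\<alpha>\<^sup>2 * N) ^ m * N \<le> real (card B) ^ m * N"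
      using cardB \<alpha> N by (intro mult_right_mono power_mono) auto
    also have "\<dots> \<le> 2 * card T * N ^ m" using T(3) .
    finally have "N ^ m * (\<alpha> ^ (2 * m) * N) \<le> N ^ m * (2 * card T)"
      unfolding power_mult[of \<alpha> 2 m] by (simp add: power_mult_distrib mult_ac)
    then have "\<alpha> ^ (2 * m) * N \<le> 2 * card T" using N by (simp add: mult_le_cancel_left_pos)
    then have "exp (real r / 16) * (\<alpha> ^ (2 * m) * N) \<le> exp (real r / 16) * (2 * card T)"
      by (intro mult_left_mono) auto
    also have "\<dots> \<le> 2 * N" using r(2) by (simp add: N_def)
    finally have "exp (real r / 16) * \<alpha> ^ (2 * m) \<le> 2" using N by simp
    then have "ln (exp (real r / 16) * \<alpha> ^ (2 * m)) \<le> ln 2"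
      using \<alpha> by (subst ln_le_cancel_iff) auto
    then have "r / 16 - 2 * m * ln (1 / \<alpha>) \<le> ln 2"
      using \<alpha> by (simp add: ln_mult ln_realpow ln_div)
    then have "r \<le> 16 * (ln 2 + 2 * m * ln (1 / \<alpha>))" by simp
    then have "real (r + d) \<le> real n" using dims by simp
    then show ?thesis by simp
  qed
  have "5 ^ r * 5 ^ d \<le> (5::nat) ^ n"
    using \<open>r + d \<le> n\<close> by (simp flip: power_add)
  also note r(1)
  finally have dV: "5 ^ d \<le> card (annihilator n (large_spectrum n T))" by simp
  have "finite (annihilator n (large_spectrum n T))"
    by (rule finite_subset[OF _ finite_F5_space[of n]]) (auto simp: annihilator_def)
  then obtain W where W: "W \<subseteq> annihilator n (large_spectrum n T)" "F5.subspace W" "F5.dim W = d" "finite W" "card W \<le> 5 ^ d"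
    using F5_subspace_of_dim_exists[OF subspace_annihilator _ dV] by blast
  have WG: "W \<subseteq> ?G" using W(1) by (auto simp: annihilator_def)
  \<comment> \<open>Union bound: otherwise every point of \<open>X\<close> has a translate by
    \<open>W\<close> where \<open>h\<close> is at least 1/8, and summing \<open>h\<close> over all
    translates contradicts \<open>small\<close>.\<close>
  have "\<exists>x\<in>X. \<forall>v\<in>W. h (x + v) < 1 / 8"
  proof (rule ccontr)
    assume "\<not> ?thesis"
    then have bad: "\<exists>v\<in>W. 1 / 8 \<le> h (x + v)" if "x \<in> X" for x using that by (auto simp: not_less)
    have "\<alpha> * N / 8 \<le> (\<Sum>x\<in>X. 1 / 8)" using cardA X(2) by (simp add: N_def)
    also have "\<dots> \<le> (\<Sum>x\<in>X. \<Sum>v\<in>W. h (x + v))"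
    proof (rule sum_mono)
      fix x assume "x \<in> X"
      then obtain v where v: "v \<in> W" "1 / 8 \<le> h (x + v)" using bad by blast
      then show "1 / 8 \<le> (\<Sum>v\<in>W. h (x + v))"
        using member_le_sum[of v W "\<lambda>v. h (x + v)"] h(1) W(4) by fastforce
    qed
    also have "\<dots> \<le> (\<Sum>x\<in>?G. \<Sum>v\<in>W. h (x + v))"
      using X(1) finite_F5_space h(1) by (intro sum_mono2) (auto intro: sum_nonneg)
    also have "\<dots> = (\<Sum>v\<in>W. \<Sum>x\<in>?G. h (x + v))" by (rule sum.swap)
    also have "\<dots> = (\<Sum>v\<in>W. \<Sum>x\<in>?G. h x)"
      using WG by (intro sum.cong refl F5_space.sum_translate) auto
    also have "\<dots> = card W * (\<Sum>x\<in>?G. h x)" by simp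
    also have "\<dots> \<le> 5 ^ d * (2 * real k * (4 * E * N))"
    proof (rule mult_mono)
      have "real (card W) \<le> real (5 ^ d)" using W(5) by (simp only: of_nat_le_iff)
      then show "real (card W) \<le> 5 ^ d" by simp
    qed (use h in \<open>auto intro: sum_nonneg\<close>)
    finally have "\<alpha> * N \<le> (64 * k * 5 ^ d * E) * N" by (simp add: algebra_simps)
    then have "\<alpha> \<le> 64 * k * 5 ^ d * E" using N by simp
    then show False using small by (simp add: E_def)
  qed
  then obtain x where x: "x \<in> X" "\<And>v. v \<in> W \<Longrightarrow> h (x + v) < 1 / 8" by blast
  have xG: "x \<in> ?G" using x X by blast
  have "h x < 1 / 8" using x(2)[of 0] F5.subspace_0[OF W(2)] by simp
  then have Fx: "F x > 3 / 4" using h(2)[OF xG] fX[OF x(1)] by linarith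
  \<comment> \<open>From \<open>F x > 3 / 4\<close>, at most 1/4 is lost in moving along
    \<open>v\<close>, 1/8 in passing from \<open>F\<close> back to \<open>f\<close>, and less than
    1/8 to \<open>h\<close>; more than 1/4 remains.\<close>
  have "f (x + v) > 0" if v: "v \<in> W" for v
  proof -
    have "(F (x + v) - F x)\<^sup>2 \<le> 4 / 16 ^ k * 5 ^ n / card B"
      unfolding F_def f_def using T v W(1) B u xG by (intro smooth_iter_mean_over_translate) auto
    also have "\<dots> = 4 / 16 ^ k * N / card B" by (simp add: N_def)
    also have "\<dots> \<le> 4 / 16 ^ k * N / (\<alpha>\<^sup>2 * N)"
      using cardB cB \<alpha> N by (intro divide_left_mono) auto
    also have "\<dots> = 4 / (4 ^ k * \<alpha>)\<^sup>2"
      using N by (simp add: power_mult_distrib power2_eq_square flip: power_mult_distrib[of 4 4])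
    \<comment> \<open>Here \<open>8 / \<alpha> \<le> 4 ^ k\<close> enters: the smoothings beat the
      loss \<open>1 / \<alpha>\<^sup>2\<close> caused by the density of \<open>B\<close>.\<close>
    also have "\<dots> \<le> 4 / 8\<^sup>2"
      using k \<alpha> by (intro divide_left_mono power_mono) (auto simp: field_simps)
    finally have "(F (x + v) - F x)\<^sup>2 \<le> (1 / 4)\<^sup>2" by (simp add: power2_eq_square)
    then have "\<bar>F (x + v) - F x\<bar> \<le> 1 / 4" by (simp add: abs_le_square_iff[symmetric])
    moreover have "x + v \<in> ?G" using xG v WG F5_space.add_mem by blast
    then have "\<bar>F (x + v) - f (x + v)\<bar> \<le> 1 / 8 + h (x + v)" by (rule h(2))
    ultimately show ?thesis using Fx x(2)[OF v] by linarith
  qed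
  then have "x +o W \<subseteq> A + A + A" using fpos by (auto simp: elt_set_plus_def)
  moreover have "affine_subspace_of_dim n d (x +o W)"
    unfolding affine_subspace_of_dim_def using xG WG W by blast
  ultimately show ?thesis by blast
qed

section \<open>Choice of the parameters\<close>

lemma ln_2_bounds: "1 / 2 \<le> ln (2::real)" "ln (2::real) \<le> 1"
proof -
  have "exp (1 / 2) \<le> (2::real)" using exp_le_quadratic[of "1 / 2"] by (simp add: power2_eq_square)
  then show "1 / 2 \<le> ln (2::real)" by (subst ln_ge_iff) auto
  show "ln (2::real) \<le> 1" using ln_le_minus_one[of "2::real"] by simp
qed

text \<open>Take k of order L and m of order k^2 (L + d). The codimension, controlled by m ln
  (1/\<alpha>), is then at most of order L^3 (L + d), the source of the cube.\<close>

lemma affine_subspace_in_triple_sum_log: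
  fixes \<alpha> :: real and d :: nat
  assumes A: "A \<subseteq> F5_space n" and cardA: "real (card A) \<ge> \<alpha> * 5 ^ n"
    and \<alpha>: "0 < \<alpha>" "\<alpha> \<le> 1" and L: "L = ln (2 / \<alpha>)"
    and n: "12000000 * (L ^ 3 * (L + d)) \<le> n"
  shows "\<exists>S. affine_subspace_of_dim n d S \<and> S \<subseteq> A + A + A"
proof -
  define l where "l = ln (1 / \<alpha>)"
  have l: "0 \<le> l" "L = ln 2 + l" using \<alpha> by (auto simp: l_def L ln_div)
  note ln2 = ln_2_bounds
  have L12: "1 / 2 \<le> L" using l ln2 by simp
  \<comment> \<open>Since \<open>ln (8 / \<alpha>) \<le> 3 * L\<close> and ln 4 is at least 1, this
    many smoothings suffice; L at least 1/2 absorbs the rounding into \<open>5 * L\<close>.\<close>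
  define k where "k = nat \<lceil>3 * L\<rceil>"
  have k: "3 * L \<le> k" "k \<le> 5 * L" "0 < k" using L12 by (auto simp: k_def) linarith+
  have ln_pow2: "ln ((2::real) ^ j) = j * ln 2" for j by (simp add: ln_realpow)
  have k4: "8 / \<alpha> \<le> 4 ^ k"
  proof -
    have step: "3 * L * 1 \<le> 3 * L * (2 * ln 2)" using ln2 L12 by (intro mult_left_mono) auto
    have "ln (8 / \<alpha>) = 3 * ln 2 + l"
      using \<alpha> ln_pow2[of 3] by (simp add: l_def ln_div)
    also have "\<dots> \<le> 3 * L * (2 * ln 2)" using step l by simp
    also have "\<dots> \<le> k * (2 * ln 2)" using k(1) ln2 by (simp add: mult_right_mono)
    also have "\<dots> = ln (4 ^ k)" using ln_pow2[of 2] by (simp add: ln_realpow)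
    finally show ?thesis using \<alpha> by (subst (asm) ln_le_cancel_iff) auto
  qed
  \<comment> \<open>The factor \<open>1024 * (real k)\<^sup>2\<close> cancels the denominator in
    \<open>small\<close>, and \<open>13 * L + 4 * d\<close> exceeds the logarithm of 64 k 5^d /
    \<alpha>.\<close>
  define M where "M = 1024 * (real k)\<^sup>2 * (13 * L + 4 * d)"
  define m where "m = nat \<lceil>M\<rceil>"
  have "0 < M" using k L12 by (simp add: M_def add_pos_nonneg)
  then have "real m = of_int \<lceil>M\<rceil>" by (simp add: m_def)
  then have m: "M \<le> m" "m \<le> M + 1" by linarith+
  with \<open>0 < M\<close> have "0 < m" by linarith
  have small: "64 * k * 5 ^ d * exp (- (m / (1024 * k\<^sup>2))) < \<alpha>"
  proof -
    have "ln (64 * real k * 5 ^ d) = 6 * ln 2 + ln k + d * ln 5"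
      using k ln_pow2[of 6] by (simp add: ln_mult ln_realpow)
    moreover have "ln (real k) \<le> real k - 1" using k by (intro ln_le_minus_one) auto
    moreover have "d * ln 5 \<le> d * (4::real)"
      using ln_le_minus_one[of "5::real"] by (intro mult_left_mono) auto
    ultimately have "ln (64 * real k * 5 ^ d) < 13 * L + 4 * d - l" using k(2) l ln2 by linarith
    also have "13 * L + 4 * d \<le> m / (1024 * k\<^sup>2)"
      using m(1) k by (simp add: M_def field_simps)
    finally have "exp (ln (64 * real k * 5 ^ d)) < exp (m / (1024 * k\<^sup>2) - l)" by simp
    also have "exp (m / (1024 * k\<^sup>2) - l) = exp (m / (1024 * k\<^sup>2)) * \<alpha>"
      using \<alpha> by (simp add: exp_diff l_def)
    finally have "64 * real k * 5 ^ d < exp (m / (1024 * k\<^sup>2)) * \<alpha>" using k by simp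
    then show ?thesis by (simp add: exp_minus field_simps)
  qed
  have dims: "16 * (ln 2 + 2 * m * ln (1 / \<alpha>)) + d \<le> n"
  proof -
    define P where "P = L ^ 3 * (L + d)"
    have L2: "1 / 4 \<le> L\<^sup>2" using power_mono[OF L12, of 2] by (simp add: power2_eq_square)
    have L3: "1 / 8 \<le> L ^ 3" using power_mono[OF L12, of 3] by (simp add: power3_eq_cube)
    have Ld: "L + d \<le> 8 * P"
      using mult_right_mono[OF L3, of "8 * (L + d)"] L12 by (simp add: P_def algebra_simps)
    have "M \<le> 1024 * (5 * L)\<^sup>2 * (13 * (L + d))"
      unfolding M_def using k L12 by (intro mult_mono power_mono) auto
    then have "M \<le> 332800 * (L\<^sup>2 * (L + d))" by (simp add: power_mult_distrib algebra_simps)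
    moreover have "1 / 4 * (1 / 2) \<le> L\<^sup>2 * (L + d)" using L2 L12 by (intro mult_mono) auto
    ultimately have "m \<le> 332808 * (L\<^sup>2 * (L + d))" using m(2) by linarith
    then have "m * l \<le> 332808 * (L\<^sup>2 * (L + d)) * L"
      using l ln2 L12 by (intro mult_mono) auto
    also have "\<dots> = 332808 * P" by (simp add: P_def power3_eq_cube power2_eq_square)
    finally have ml: "m * l \<le> 332808 * P" .
    have "16 * ln 2 + d \<le> 16 * (L + d)" using l by simp
    then have "16 * (ln 2 + 2 * m * l) + d \<le> 16 * (8 * P) + 32 * (332808 * P)"
      using ml Ld by (simp add: algebra_simps)
    \<comment> \<open>The coefficients add up to 10649984.\<close>
    also have "\<dots> \<le> 12000000 * P" using Ld L12 by simp
    finally show ?thesis using n by (simp add: P_def l_def)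
  qed
  show ?thesis by (rule affine_subspace_in_triple_sum[OF A cardA \<alpha>(1) k4 k(3) \<open>0 < m\<close> small dims])
qed

section \<open>From the parameter inequality to the stated dimension\<close>

theorem theorem1p7:
  shows "\<exists>c::real. c > 0 \<and>
    (\<forall>(n::nat) (\<alpha>::real) (A::(nat \<Rightarrow> gf5) set).
       n \<ge> 1 \<longrightarrow> 0 < \<alpha> \<longrightarrow> \<alpha> \<le> 1 \<longrightarrow>
       A \<subseteq> F5_space n \<longrightarrow> real (card A) \<ge> \<alpha> * 5 ^ n \<longrightarrow>
       (\<exists>S d. affine_subspace_of_dim n d S \<and> S \<subseteq> A + A + A \<and>
          real d \<ge> c * real n / ln (2 / \<alpha>) ^ 3 - ln (1 / \<alpha>)))"
proof -
  define C :: real where "C = 12000000"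
  \<comment> \<open>For \<open>n \<ge> n0\<close> the additive term 16 C below is at most n/2. Then
    \<open>c\<close> is small enough both for 8 C c \<le> 1 and for 8 c n 5^n \<le> 1 whenever
    \<open>n < n0\<close>.\<close>
  define n0 :: nat where "n0 = 32 * 12000000"
  define c where "c = 1 / (8 * C * real n0 * 5 ^ n0)"
  have C: "C \<ge> 1" by (simp add: C_def)
  have n0: "real n0 = 32 * C" "1 \<le> real n0" by (simp_all add: n0_def C_def)
  have pow: "1 \<le> (5::real) ^ n0" by simp
  have c: "0 < c" using C n0 by (simp add: c_def)
  have c1: "8 * C * c * (real n0 * 5 ^ n0) = 1" using C n0 by (simp add: c_def)
  have np: "1 \<le> real n0 * 5 ^ n0" using mult_mono[OF n0(2) pow] by simp
  have cC: "8 * C * c \<le> 1"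
  proof -
    have "8 * C * c * 1 \<le> 8 * C * c * (real n0 * 5 ^ n0)"
      using c C by (intro mult_left_mono[OF np]) auto
    then show ?thesis using c1 by simp
  qed
  have c8: "8 * c * (real n0 * 5 ^ n0) \<le> 1"
  proof -
    have "1 * (8 * c * (real n0 * 5 ^ n0)) \<le> C * (8 * c * (real n0 * 5 ^ n0))"
      using C c by (intro mult_right_mono) auto
    then show ?thesis using c1 by (simp add: mult_ac)
  qed
  have "\<exists>S d. affine_subspace_of_dim n d S \<and> S \<subseteq> A + A + A \<and>
      real d \<ge> c * real n / ln (2 / \<alpha>) ^ 3 - ln (1 / \<alpha>)"
    if n: "n \<ge> 1" and \<alpha>: "0 < \<alpha>" "\<alpha> \<le> 1" and A: "A \<subseteq> F5_space n"
      and cardA: "real (card A) \<ge> \<alpha> * 5 ^ n" for n \<alpha> A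
  proof -
    define L where "L = ln (2 / \<alpha>)"
    define l where "l = ln (1 / \<alpha>)"
    define y where "y = c * n / L ^ 3 - l"
    have l: "0 \<le> l" "L = ln 2 + l" using \<alpha> by (auto simp: l_def L_def ln_div)
    note ln2 = ln_2_bounds
    have L12: "1 / 2 \<le> L" using l ln2 by simp
    have L3: "1 / 8 \<le> L ^ 3" using power_mono[OF L12, of 3] by (simp add: power3_eq_cube)
    have finA: "finite A" using A finite_F5_space finite_subset by blast
    have ne: "A \<noteq> {}"
    proof
      assume "A = {}"
      moreover have "0 < \<alpha> * 5 ^ n" using \<alpha> by simp
      ultimately show False using cardA by simp
    qed
    \<comment> \<open>A single point settles nonpositive \<open>y\<close>. For
      \<open>n < n0\<close>, positivity of \<open>y\<close> forces \<open>A\<close> to be the whole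
      space; for larger \<open>n\<close> the preceding lemma applies with \<open>d\<close> the
      ceiling of \<open>y\<close>.\<close>
    consider (trivial) "y \<le> 0" | (small) "y > 0" "n < n0" | (large) "y > 0" "n0 \<le> n" by linarith
    then show ?thesis
    proof cases
      case trivial
      obtain a where a: "a \<in> A" using ne by blast
      have "a + a + a \<in> A + A + A" using a by (intro set_plus_intro)
      then have sub: "(a + a + a) +o {0} \<subseteq> A + A + A" by (simp add: elt_set_plus_def)
      have "F5.dim {0} = 0"
        using F5.dim_span_eq_card_independent[OF F5.independent_empty] unfolding F5.span_empty by simp
      moreover have "a + a + a \<in> F5_space n" using a A F5_space.add_mem by blast
      ultimately have "affine_subspace_of_dim n 0 ((a + a + a) +o {0})"
        unfolding affine_subspace_of_dim_def
        using F5_space.zero_mem F5.subspace_single_0 by blast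
      then show ?thesis
        using trivial sub by (intro exI[of _ "(a + a + a) +o {0}"] exI[of _ 0]) (simp add: y_def L_def l_def)
    next
      case small
      \<comment> \<open>Here \<open>\<alpha>\<close> is so close to 1 that \<open>A\<close> misses fewer than one point.\<close>
      have "c * n / L ^ 3 \<le> c * n / (1 / 8)" using L3 L12 c by (intro divide_left_mono) auto
      then have y8: "y \<le> 8 * c * n - l" by (simp add: y_def)
      have "real n * 5 ^ n \<le> real n0 * 5 ^ n0"
        using small(2) by (intro mult_mono power_increasing) auto
      then have "8 * c * (real n * 5 ^ n) \<le> 8 * c * (real n0 * 5 ^ n0)" using c by (intro mult_left_mono) auto
      then have "8 * c * (real n * 5 ^ n) \<le> 1" using c8 by linarith
      moreover have "l * 5 ^ n < (8 * c * n) * 5 ^ n" using small(1) y8 by (intro mult_strict_right_mono) auto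
      moreover have "(8 * c * n) * 5 ^ n = 8 * c * (real n * 5 ^ n)" by simp
      ultimately have "l * 5 ^ n < 1" by linarith
      moreover have "(1 - \<alpha>) * 5 ^ n \<le> l * 5 ^ n"
        using ln_le_minus_one[of \<alpha>] \<alpha> by (intro mult_right_mono) (auto simp: l_def ln_div)
      ultimately have "5 ^ n - \<alpha> * 5 ^ n < 1" by (simp add: algebra_simps)
      then have "real (5 ^ n) < real (card A + 1)" using cardA by simp
      then have "card (F5_space n) \<le> card A" unfolding of_nat_less_iff by (simp add: card_F5_space)
      then have AG: "A = F5_space n" using A finite_F5_space by (metis card_seteq)
      have V: "F5.subspace (F5_space n)" using subspace_annihilator[of n "{}"] by (simp add: annihilator_def)
      obtain W where W: "W \<subseteq> F5_space n" "F5.subspace W" "F5.dim W = n"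
        using F5_subspace_of_dim_exists[OF V finite_F5_space, of n] by (auto simp: card_F5_space)
      have "x \<in> A + A + A" if "x \<in> F5_space n" for x
      proof -
        have "x + 0 + 0 \<in> A + A + A"
          unfolding AG using that F5_space.zero_mem by (intro set_plus_intro)
        then show ?thesis by simp
      qed
      then have "0 +o W \<subseteq> A + A + A" using W(1) by (auto simp: elt_set_plus_def)
      moreover have "affine_subspace_of_dim n n (0 +o W)"
        unfolding affine_subspace_of_dim_def using W F5_space.zero_mem by blast
      moreover have "y \<le> n"
      proof -
        have "1 * (8 * c) \<le> C * (8 * c)" using C c by (intro mult_right_mono) auto
        then have "8 * c \<le> 1" using cC by simp
        then have "8 * c * n \<le> 1 * real n" by (intro mult_right_mono) auto
        then show ?thesis using y8 l by linarith
      qed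
      ultimately show ?thesis by (intro exI[of _ "0 +o W"] exI[of _ n]) (simp add: y_def L_def l_def)
    next
      case large
      define d where "d = nat \<lceil>y\<rceil>"
      then have "real d = of_int \<lceil>y\<rceil>" using large by simp
      then have d: "y \<le> d" "d \<le> y + 1" by linarith+
      have L3p: "0 < L ^ 3" using L3 by linarith
      have yl: "L ^ 3 * y = c * n - L ^ 3 * l" using L3p by (simp add: y_def field_simps)
      have "0 < L ^ 3 * y" using L3p large(1) by simp
      then have L3l: "L ^ 3 * l \<le> c * n" using yl by simp
      \<comment> \<open>Positivity of \<open>y\<close> gives \<open>L ^ 3 * l \<le> c * n\<close>,
        which controls \<open>L ^ 3\<close> when \<open>l \<ge> 1\<close>; otherwise
        \<open>L\<close> is at most 2.\<close>
      have L3': "L ^ 3 \<le> c * n + 8"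
      proof (cases "l \<ge> 1")
        case True
        then have "L ^ 3 * 1 \<le> L ^ 3 * l" using L3p by (intro mult_left_mono) auto
        then show ?thesis using L3l by simp
      next
        case False
        then have "L ^ 3 \<le> 2 ^ 3" using l ln2 L12 by (intro power_mono) auto
        moreover have "0 \<le> c * n" using c by simp
        ultimately show ?thesis by simp
      qed
      have "L ^ 3 * (L + d) \<le> L ^ 3 * ((1 + l) + (y + 1))"
        using L3p l ln2 d(2) by (intro mult_left_mono) auto
      also have "\<dots> = 2 * L ^ 3 + L ^ 3 * l + L ^ 3 * y" by (simp add: algebra_simps)
      also have "\<dots> = 2 * L ^ 3 + c * n" using yl by simp
      also have "\<dots> \<le> 3 * (c * n) + 16" using L3' by simp
      finally have "C * (L ^ 3 * (L + d)) \<le> C * (3 * (c * n) + 16)" using C by (intro mult_left_mono) auto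
      also have "\<dots> = 3 / 8 * (8 * C * c * n) + 16 * C" by (simp add: algebra_simps)
      \<comment> \<open>Both constants pay off here: \<open>cC\<close> bounds the first term and
        \<open>n0 \<le> n\<close> the second, for a total of 7 n / 8.\<close>
      also have "\<dots> \<le> 3 / 8 * (1 * real n) + real n / 2"
        using cC large(2) n0 by (intro add_mono mult_left_mono mult_right_mono) auto
      finally have "C * (L ^ 3 * (L + d)) \<le> n" by simp
      then have "\<exists>S. affine_subspace_of_dim n d S \<and> S \<subseteq> A + A + A"
        using affine_subspace_in_triple_sum_log[OF A cardA \<alpha> L_def, of d] by (simp add: C_def)
      then show ?thesis using d(1) by (auto simp: y_def L_def l_def)
    qed
  qed
  then show ?thesis using c by blast
qed

end
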